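(* Let $d\ge 1$ and let $\mathcal{A}=(A_1,A_2,\dots)$ be a sequence of $d\times d$ matrices with nonnegative entries satisfying condition $\mathbf{(C)}$ (with respect to some $0\le\lambda<1\le\Lambda<+\infty$ and some sequence of integers $0=s_0=s_1<s_2<\cdots$), and such that $P_n:=A_1\cdots A_n\neq 0$ for all $n\ge 1$. Then there exist an integer $1\le H\le d$ and $H$ probability vectors $V_1,\dots,V_H\in\mathcal{S}_d$ with $$\Delta(V_1)\ge\cdots\ge\Delta(V_H)\quad\text{and}\quad V_{h-1}\ne V_h\ \text{ for every } 1<h\le H,$$ and there exist, for every $n$ large enough, nonempty sets $J_h(n)\subset\{1,\dots,d\}$ ($1\le h\le H$) giving the partition (disjoint union) $$\{(i,j)\;;\;P_n(i,j)\ne 0\}=\bigsqcup_{h=1}^{H} I_h\times J_h(n),\qquad\text{where } I_h:=\mathcal{I}(V_h),$$ such that the following assertions hold. (i) For $1\le h\le H$ and any sequence $j_1,j_2,\dots$ in $\{1,\dots,d\}$ with $j_n\in J_h(n)$ (for all $n$ large enough), $$\lim_{n\to+\infty}\frac{P_nU_{j_n}}{\|P_nU_{j_n}\|}=V_h.$$ (ii) For $1<h\le H$ and any two sequences $j_1,j_2,\dots$ and $j'_1,j'_2,\dots$ in $\{1,\dots,d\}$ with $(j_n,j'_n)\in J_{h-1}(n)\times J_h(n)$ (for all $n$ large enough), $$\lim_{n\to+\infty}\frac{\|P_nU_{j'_n}\|}{\|P_nU_{j_n}\|}=0.$$ (iii) There exist real numbers $\varepsilon_1,\varepsilon_2,\dots$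 with $\varepsilon_n\to 0$ as $n\to+\infty$ such that, for every $X\in\mathcal{S}_d$ for which $P_nX\ne 0$ for all $n\ge1$, one has for every $n$ for which the sets $J_h(n)$ are defined (i.e. all $n$ larger than some rank independent of $X$) $$\left\|\frac{P_nX}{\|P_nX\|}-V_{\mathbf{h}_X(n)}\right\|\le\Lambda_X\cdot\varepsilon_n,\qquad\text{where } \mathbf{h}_X(n)=\min\{h\;;\;\mathcal{I}(X)\cap J_h(n)\ne\emptyset\}.$$
   Context: Notation. $U_1,\dots,U_d$ are the canonical column vectors of $\mathbb{R}^d$, so $MU_j$ is the $j$-th column of $M$. $\|\cdot\|$ is the sum of the moduli of the entries of a vector or matrix. $\mathcal{S}_d$ is the simplex of nonnegative $d\times1$ vectors $X$ with $\|X\|=1$ (probability vectors). For a column vector $V$, $\mathcal{I}(V):=\{i\;;\;V(i)\ne0\}$ and $\Delta(V):=\sum_{i\in\mathcal{I}(V)}U_i$; inequalities between vectors are entrywise, so $\Delta(V)\le\Delta(V')$ means $\mathcal{I}(V)\subset\mathcal{I}(V')$. Sets of matrices. For a nonnegative $d_1\times d_2$ matrix $A$ and reals $\lambda\ge0$, $\Lambda\ge1$: $A\in\mathcal{H}_1$ iff for all $j_0,j_1$, $\Delta(AU_{j_0})\ge\Delta(AU_{j_1})$ or $\Delta(AU_{j_0})\le\Delta(AU_{j_1})$; $A\in\mathcal{H}_2(\Lambda)$ iff for all $i_0,j_0$, $A(i_0,j_0)\ne0\Rightarrow\|AU_{j_0}\|\le\Lambda A(i_0,j_0)$; $A\in\mathcal{H}_3(\lambda)$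 iff for all $i_0,j_0,j_1$, $[A(i_0,j_0)\ne0$ and $A(i_0,j_1)=0]\Rightarrow\|AU_{j_1}\|\le\lambda A(i_0,j_0)$. For a nonnegative matrix (or column vector) $A\ne0$, $\Lambda_A:=\min\{\Lambda\ge1\;;\;A\in\mathcal{H}_2(\Lambda)\}$; in particular for $X\in\mathcal{S}_d$, $\Lambda_X=1/\min\{X(i)\;;\;X(i)\ne0\}$. Condition $\mathbf{(C)}$. Given a sequence $\mathcal{A}=(A_1,A_2,\dots)$ of nonnegative $d\times d$ matrices and integers $0=s_0=s_1<s_2<\cdots$, for $n\ge0$ let $k\ge0$ be the integer with $s_{k+1}\le n<s_{k+2}$ and put $Q_n:=A_{s_k+1}\cdots A_n$ ($Q_0$ is the identity). $\mathcal{A}$ satisfies condition $\mathbf{(C)}$ with respect to $0\le\lambda<1\le\Lambda<+\infty$ and $(s_0,s_1,\dots)$ if $Q_n\in\mathcal{H}_1\cap\mathcal{H}_2(\Lambda)\cap\mathcal{H}_3(\lambda)$ for every $n\ge s_2$. *)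

theory Defs
  imports "HOL-Analysis.Analysis"
begin

definition l1norm :: "real ^ 'n \<Rightarrow> real" where
  "l1norm V = (\<Sum>i\<in>UNIV. \<bar>V $ i\<bar>)"

definition prob_simplex :: "(real ^ 'n) set" where
  "prob_simplex = {X. (\<forall>i. 0 \<le> X $ i) \<and> l1norm X = 1}"

definition supp :: "real ^ 'n \<Rightarrow> 'n set" where
  "supp V = {i. V $ i \<noteq> 0}"

definition Delta :: "real ^ 'n \<Rightarrow> real ^ 'n" where
  "Delta V = (\<Sum>i\<in>supp V. axis i 1)"

definition nonneg_mat :: "real ^ 'n ^ 'm \<Rightarrow> bool" where
  "nonneg_mat A \<longleftrightarrow> (\<forall>i j. 0 \<le> A $ i $ j)"

definition H1 :: "(real ^ 'n ^ 'm) set" where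
  "H1 = {A. nonneg_mat A \<and>
     (\<forall>j0 j1. Delta (column j0 A) \<ge> Delta (column j1 A) \<or> Delta (column j0 A) \<le> Delta (column j1 A))}"

definition H2 :: "real \<Rightarrow> (real ^ 'n ^ 'm) set" where
  "H2 \<Lambda> = {A. nonneg_mat A \<and>
     (\<forall>i0 j0. A $ i0 $ j0 \<noteq> 0 \<longrightarrow> l1norm (column j0 A) \<le> \<Lambda> * A $ i0 $ j0)}"

definition H3 :: "real \<Rightarrow> (real ^ 'n ^ 'm) set" where
  "H3 lam = {A. nonneg_mat A \<and>
     (\<forall>i0 j0 j1. A $ i0 $ j0 \<noteq> 0 \<and> A $ i0 $ j1 = 0 \<longrightarrow>
        l1norm (column j1 A) \<le> lam * A $ i0 $ j0)}"

definition Lambda_of :: "real ^ 'n ^ 'm \<Rightarrow> real" where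
  "Lambda_of A = (LEAST \<Lambda>. 1 \<le> \<Lambda> \<and> A \<in> H2 \<Lambda>)"

definition Lambda_vec :: "real ^ 'n \<Rightarrow> real" where
  "Lambda_vec X = Lambda_of (columnvector X :: real ^ 1 ^ 'n)"

lemma Lambda_vec_prob_simplex:
  assumes "X \<in> prob_simplex"
  shows "Lambda_vec X = 1 / Min {X $ i |i. X $ i \<noteq> 0}"
proof -
  let ?S = "{X $ i |i. X $ i \<noteq> 0}"
  let ?m = "Min ?S"
  have nn: "\<And>i. 0 \<le> X $ i" and one: "l1norm X = 1"
    using assms by (auto simp: prob_simplex_def)
  have sum1: "(\<Sum>i\<in>UNIV. X $ i) = 1"
    using one nn by (simp add: l1norm_def)
  have le1: "X $ i \<le> 1" for i
    using member_le_sum[of i UNIV "\<lambda>i. X $ i"] nn sum1 by simp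
  have "\<exists>i. X $ i \<noteq> 0"
    using sum1 by (metis sum.neutral zero_neq_one)
  then have ne: "?S \<noteq> {}" by blast
  have fin: "finite ?S" by simp
  obtain i where i: "?m = X $ i" "X $ i \<noteq> 0"
    using Min_in[OF fin ne] by blast
  have mpos: "0 < ?m" using i nn[of i] by simp
  have m1: "?m \<le> 1" using i le1 by simp
  have mle: "?m \<le> X $ k" if "X $ k \<noteq> 0" for k
    using fin that by (intro Min_le) auto
  have col: "column j (columnvector X :: real ^ 1 ^ 'a) = X" for j
    by (simp add: column_def columnvector_def vec_eq_iff)
  have nonneg: "nonneg_mat (columnvector X :: real ^ 1 ^ 'a)"
    using nn by (simp add: nonneg_mat_def columnvector_def)
  have H2: "(columnvector X :: real ^ 1 ^ 'a) \<in> H2 L \<longleftrightarrow> (\<forall>k. X $ k \<noteq> 0 \<longrightarrow> 1 \<le> L * X $ k)" for L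
    using nonneg by (simp add: H2_def col one) (simp add: columnvector_def)
  show ?thesis
    unfolding Lambda_vec_def Lambda_of_def
  proof (rule Least_equality)
    have "1 \<le> 1 / ?m * X $ k" if "X $ k \<noteq> 0" for k
      using mle[OF that] mpos by (simp add: field_simps)
    then show "1 \<le> 1 / ?m \<and> (columnvector X :: real ^ 1 ^ 'a) \<in> H2 (1 / ?m)"
      using mpos m1 by (simp add: H2)
  next
    fix y assume "1 \<le> y \<and> (columnvector X :: real ^ 1 ^ 'a) \<in> H2 y"
    then have "1 \<le> y * ?m" using i H2 by simp
    then show "1 / ?m \<le> y" using mpos by (simp add: field_simps)
  qed
qed

text \<open>\<open>mat_prod A m n\<close> is the product \<open>A (m + 1) ** \<dots> ** A n\<close>, the identity if \<open>n \<le> m\<close>.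
  Sequences of matrices are indexed from 1; the value \<open>A 0\<close> is never used.\<close>

definition mat_prod :: "(nat \<Rightarrow> real ^ 'd ^ 'd) \<Rightarrow> nat \<Rightarrow> nat \<Rightarrow> real ^ 'd ^ 'd" where
  "mat_prod A m n = foldr (\<lambda>k M. A k ** M) [Suc m..<Suc n] (mat 1)"

definition P :: "(nat \<Rightarrow> real ^ 'd ^ 'd) \<Rightarrow> nat \<Rightarrow> real ^ 'd ^ 'd" where
  "P A n = mat_prod A 0 n"

definition block_seq :: "(nat \<Rightarrow> nat) \<Rightarrow> bool" where
  "block_seq s \<longleftrightarrow> s 0 = 0 \<and> s 1 = 0 \<and> (\<forall>k\<ge>1. s k < s (Suc k))"

definition block_index :: "(nat \<Rightarrow> nat) \<Rightarrow> nat \<Rightarrow> nat" where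
  "block_index s n = (THE k. s (k + 1) \<le> n \<and> n < s (k + 2))"

lemma block_index_unique:
  assumes "block_seq s"
  shows "\<exists>!k. s (k + 1) \<le> n \<and> n < s (k + 2)"
proof -
  have step: "s (Suc k) < s (Suc (Suc k))" for k
    using assms by (simp add: block_seq_def)
  then have sm: "strict_mono (\<lambda>k. s (Suc k))"
    by (simp add: strict_mono_Suc_iff)
  define k where "k = (LEAST k. n < s (k + 2))"
  have "n < s (n + 2)"
    using strict_mono_imp_increasing[OF sm, of "Suc n"] by simp
  then have k: "n < s (k + 2)"
    unfolding k_def by (rule LeastI)
  have k': "s (k + 1) \<le> n"
  proof (cases k)
    case 0
    then show ?thesis using assms by (simp add: block_seq_def)
  next
    case (Suc l)
    then have "\<not> n < s (l + 2)"
      unfolding k_def by (intro not_less_Least) simp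
    then show ?thesis using Suc by simp
  qed
  have "l = k" if l: "s (l + 1) \<le> n" "n < s (l + 2)" for l
  proof -
    have "s (Suc l) < s (Suc (Suc k))" "s (Suc k) < s (Suc (Suc l))"
      using k k' l by simp_all
    then have "l < Suc k" "k < Suc l"
      using strict_mono_less[OF sm] by blast+
    then show ?thesis by simp
  qed
  with k k' show ?thesis by blast
qed

definition Q :: "(nat \<Rightarrow> real ^ 'd ^ 'd) \<Rightarrow> (nat \<Rightarrow> nat) \<Rightarrow> nat \<Rightarrow> real ^ 'd ^ 'd" where
  "Q A s n = mat_prod A (s (block_index s n)) n"

definition condition_C ::
  "(nat \<Rightarrow> real ^ 'd ^ 'd) \<Rightarrow> real \<Rightarrow> real \<Rightarrow> (nat \<Rightarrow> nat) \<Rightarrow> bool" where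
  "condition_C A lam \<Lambda> s \<longleftrightarrow>
     0 \<le> lam \<and> lam < 1 \<and> 1 \<le> \<Lambda> \<and> block_seq s \<and>
     (\<forall>n\<ge>s 2. Q A s n \<in> H1 \<inter> H2 \<Lambda> \<inter> H3 lam)"

end

theory Submission
  imports Defs
begin

text \<open>
  Fix a level \<open>k\<close> and cut \<open>P A n = head k ** tail k n\<close> at a block boundary. The classes \<open>H1\<close>, \<open>H2\<close>, \<open>H3\<close>
  are stable under multiplication: a product of \<open>r\<close> blocks is in \<open>H1\<close>, in \<open>H2\<close> with the uniform
  constant \<open>\<Lambda> / (1 - lam)\<close> (\<open>balanced_mult_vec\<close>), and in \<open>H3\<close> with constant \<open>lam ^ r\<close>
  (\<open>H3_matrix_mult\<close>). So every column of \<open>tail k n\<close> is balanced, the supports of these columns form a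
  chain, and a column whose support is strictly smaller than that of another one is negligible
  compared with it as \<open>n\<close> grows.

  Two balanced vectors with the same support have bounded ratios, and each block shrinks the range of
  the ratios by a fixed factor (\<open>between_mult_vec_contracts\<close>). Hence the direction of \<open>head k *v V\<close>
  depends, up to an error geometric in \<open>k\<close>, only on the support of \<open>V\<close> (\<open>head_direction_diff\<close>). The
  direction of a column of \<open>P A n\<close> is thus almost a function of its support at level \<open>k\<close>, that is, of
  the support of the corresponding column of \<open>tail k n\<close>.

  By \<open>H1\<close> the set of supports at level \<open>k\<close> can only shrink as \<open>n\<close> grows, so it is eventually constant.
  Its final cardinality is nondecreasing in \<open>k\<close> and at most the dimension; let it be maximal at
  \<open>top_level\<close>. Then two columns with the same support at the top level also have, for large \<open>n\<close>, the same
  support at any given higher level, so along such a class of columns the directions are Cauchy, while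
  between two classes the quotient of the norms tends to 0 (\<open>class_dominates\<close>).

  Different classes can have the same limit direction, and then need not be neighbours in the chain:
  \<open>V 1 = V 3 \<noteq> V 2\<close> is possible. So only neighbouring classes with a common limit are merged
  (\<open>chain_grouping\<close>), which gives the vectors \<open>V h\<close> and the sets \<open>J h n\<close>. For a general vector \<open>X\<close>, the
  direction of \<open>P A n *v X\<close> is an average of the directions of columns, in which the first group that
  meets the support of \<open>X\<close> carries almost all the weight (\<open>direction_mult_vec_near\<close>).
\<close>

section \<open>Supports and the entrywise norm\<close>

lemma in_supp_iff: "i \<in> supp V \<longleftrightarrow> V $ i \<noteq> 0"
  by (simp add: supp_def)

lemma supp_empty_iff: "supp V = {} \<longleftrightarrow> V = 0"
  by (auto simp: supp_def vec_eq_iff)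

lemma Delta_nth: "Delta V $ i = (if i \<in> supp V then 1 else 0)"
  unfolding Delta_def by (simp add: axis_def if_distrib cong: if_cong)

lemma Delta_le_iff: "Delta V \<le> Delta W \<longleftrightarrow> supp V \<subseteq> supp W"
  by (auto simp: less_eq_vec_def Delta_nth split: if_splits)

definition nonneg_vec :: "real ^ 'n \<Rightarrow> bool" where
  "nonneg_vec V \<longleftrightarrow> (\<forall>i. 0 \<le> V $ i)"

lemma nonneg_vecD: "nonneg_vec V \<Longrightarrow> 0 \<le> V $ i"
  by (simp add: nonneg_vec_def)

lemma l1norm_nonneg_vec: "nonneg_vec V \<Longrightarrow> l1norm V = (\<Sum>i\<in>UNIV. V $ i)"
  by (simp add: l1norm_def nonneg_vec_def)

lemma l1norm_ge_0: "0 \<le> l1norm V"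
  by (simp add: l1norm_def sum_nonneg)

lemma l1norm_zero: "l1norm 0 = 0"
  by (simp add: l1norm_def)

lemma l1norm_eq_0_iff: "l1norm V = 0 \<longleftrightarrow> V = 0"
  by (simp add: l1norm_def vec_eq_iff sum_nonneg_eq_0_iff)

lemma l1norm_pos_iff: "0 < l1norm V \<longleftrightarrow> V \<noteq> 0"
  using l1norm_ge_0[of V] l1norm_eq_0_iff[of V] by linarith

lemma abs_entry_le_l1norm: "\<bar>V $ i\<bar> \<le> l1norm V"
  unfolding l1norm_def by (rule member_le_sum) auto

lemma entry_le_l1norm: "V $ i \<le> l1norm V"
  using abs_entry_le_l1norm[of V i] by linarith

lemma l1norm_scaleR: "l1norm (c *\<^sub>R V) = \<bar>c\<bar> * l1norm V"
  by (simp add: l1norm_def abs_mult sum_distrib_left)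

lemma l1norm_add_le: "l1norm (V + W) \<le> l1norm V + l1norm W"
  unfolding l1norm_def sum.distrib[symmetric] by (rule sum_mono) simp

lemma l1norm_diff_le: "l1norm (V - W) \<le> l1norm V + l1norm W"
  unfolding l1norm_def sum.distrib[symmetric] by (rule sum_mono) simp

lemma l1norm_sum_le: "l1norm (\<Sum>k\<in>K. f k) \<le> (\<Sum>k\<in>K. l1norm (f k))"
proof (induction K rule: infinite_finite_induct)
  case (insert k K)
  then show ?case using l1norm_add_le[of "f k" "sum f K"] by simp
qed (simp_all add: l1norm_zero)

lemma norm_le_l1norm: "norm V \<le> l1norm V"
  unfolding l1norm_def by (rule norm_le_l1_cart)

lemma tendsto_l1norm: "(f \<longlongrightarrow> V) F \<Longrightarrow> ((\<lambda>x. l1norm (f x)) \<longlongrightarrow> l1norm V) F"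
  unfolding l1norm_def by (intro tendsto_intros)

section \<open>Nonnegative matrices acting on nonnegative vectors\<close>

lemma nonneg_matD: "nonneg_mat M \<Longrightarrow> 0 \<le> M $ i $ j"
  by (simp add: nonneg_mat_def)

lemma nonneg_column: "nonneg_mat M \<Longrightarrow> nonneg_vec (column j M)"
  by (simp add: nonneg_mat_def nonneg_vec_def column_def)

lemma column_nth: "column j M $ i = M $ i $ j"
  by (simp add: column_def)

lemma column_matrix_mult: "column j (M ** N) = M *v column j N"
  by (simp add: vec_eq_iff column_def matrix_matrix_mult_def matrix_vector_mult_def)

lemma mult_vec_nth: "(M *v V) $ i = (\<Sum>j\<in>UNIV. M $ i $ j * V $ j)"
  by (simp add: matrix_vector_mult_def)

lemma nonneg_mult_vec:
  fixes M :: "real ^ 'n ^ 'm"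
  assumes "nonneg_mat M" "nonneg_vec V"
  shows "nonneg_vec (M *v V)"
  using assms by (auto simp: nonneg_mat_def nonneg_vec_def mult_vec_nth intro!: sum_nonneg)

lemma nonneg_matrix_mult:
  fixes M :: "real ^ 'n ^ 'm" and N :: "real ^ 'p ^ 'n"
  assumes "nonneg_mat M" "nonneg_mat N"
  shows "nonneg_mat (M ** N)"
  using assms by (auto simp: nonneg_mat_def matrix_matrix_mult_def intro!: sum_nonneg)

lemma term_le_mult_vec_nth:
  fixes M :: "real ^ 'n ^ 'm"
  assumes "nonneg_mat M" "nonneg_vec V"
  shows "M $ i $ j * V $ j \<le> (M *v V) $ i"
  unfolding mult_vec_nth
  using assms by (intro member_le_sum) (auto simp: nonneg_mat_def nonneg_vec_def)

lemma in_supp_mult_vec_iff: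
  fixes M :: "real ^ 'n ^ 'm"
  assumes "nonneg_mat M" "nonneg_vec V"
  shows "i \<in> supp (M *v V) \<longleftrightarrow> (\<exists>j\<in>supp V. M $ i $ j \<noteq> 0)"
proof -
  have "(\<Sum>j\<in>UNIV. M $ i $ j * V $ j) = 0 \<longleftrightarrow> (\<forall>j\<in>UNIV. M $ i $ j * V $ j = 0)"
    using assms by (intro sum_nonneg_eq_0_iff) (auto simp: nonneg_mat_def nonneg_vec_def)
  then show ?thesis by (auto simp: in_supp_iff mult_vec_nth)
qed

lemma supp_mult_vec_cong:
  fixes M :: "real ^ 'n ^ 'm"
  assumes "nonneg_mat M" "nonneg_vec V" "nonneg_vec W" "supp V = supp W"
  shows "supp (M *v V) = supp (M *v W)"
  using assms by (auto simp: in_supp_mult_vec_iff)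

definition image_support :: "real ^ 'n ^ 'm \<Rightarrow> 'n set \<Rightarrow> 'm set" where
  "image_support M S = {i. \<exists>j\<in>S. M $ i $ j \<noteq> 0}"

lemma supp_mult_vec_eq_image_support:
  "nonneg_mat M \<Longrightarrow> nonneg_vec V \<Longrightarrow> supp (M *v V) = image_support M (supp V)"
  for M :: "real ^ 'n ^ 'm"
  by (auto simp: image_support_def in_supp_mult_vec_iff)

lemma l1norm_mult_vec:
  fixes M :: "real ^ 'n ^ 'm"
  assumes "nonneg_mat M" "nonneg_vec V"
  shows "l1norm (M *v V) = (\<Sum>j\<in>UNIV. V $ j * l1norm (column j M))"
proof -
  have "l1norm (M *v V) = (\<Sum>i\<in>UNIV. \<Sum>j\<in>UNIV. M $ i $ j * V $ j)"
    by (simp add: l1norm_nonneg_vec nonneg_mult_vec assms mult_vec_nth)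
  also have "\<dots> = (\<Sum>j\<in>UNIV. \<Sum>i\<in>UNIV. M $ i $ j * V $ j)"
    by (rule sum.swap)
  also have "\<dots> = (\<Sum>j\<in>UNIV. V $ j * l1norm (column j M))"
    by (simp add: l1norm_nonneg_vec nonneg_column assms column_nth sum_distrib_left mult.commute)
  finally show ?thesis .
qed

lemma l1norm_mult_vec_upper:
  fixes M :: "real ^ 'n ^ 'm"
  assumes M: "nonneg_mat M" and V: "nonneg_vec V"
  shows "l1norm (M *v V) \<le> (\<Sum>j\<in>UNIV. l1norm (column j M)) * l1norm V"
proof -
  have "l1norm (M *v V) \<le> (\<Sum>j\<in>UNIV. l1norm V * l1norm (column j M))"
    unfolding l1norm_mult_vec[OF M V]
    by (intro sum_mono mult_right_mono entry_le_l1norm l1norm_ge_0)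
  then show ?thesis by (simp add: sum_distrib_left mult.commute)
qed

lemma mult_vec_columns: "M *v V = (\<Sum>j\<in>UNIV. V $ j *\<^sub>R column j M)"
  for M :: "real ^ 'n ^ 'm"
  by (simp add: vec_eq_iff mult_vec_nth column_nth mult.commute)

section \<open>The three matrix classes under multiplication\<close>

definition balanced :: "real \<Rightarrow> real ^ 'n \<Rightarrow> bool" where
  "balanced L V \<longleftrightarrow> nonneg_vec V \<and> (\<forall>i\<in>supp V. l1norm V \<le> L * V $ i)"

lemma balanced_nonneg: "balanced L V \<Longrightarrow> nonneg_vec V"
  by (simp add: balanced_def)

lemma balancedD: "balanced L V \<Longrightarrow> V $ i \<noteq> 0 \<Longrightarrow> l1norm V \<le> L * V $ i"
  by (simp add: balanced_def in_supp_iff)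

lemma H2_iff: "M \<in> H2 L \<longleftrightarrow> nonneg_mat M \<and> (\<forall>j. balanced L (column j M))"
  by (auto simp: H2_def balanced_def nonneg_column in_supp_iff column_nth)

text \<open>Some nonzero entry \<open>M(i,j)\<close> meets the support of \<open>V\<close>. It is at least the least nonzero entry of
  \<open>M\<close>, and \<open>V(j)\<close> is a definite share of \<open>l1norm V\<close> because \<open>V\<close> is balanced.\<close>

lemma l1norm_mult_vec_lower:
  fixes M :: "real ^ 'n ^ 'm"
  assumes M: "nonneg_mat M" and L: "0 \<le> L"
  obtains c where "\<And>V. balanced L V \<Longrightarrow> M *v V \<noteq> 0 \<Longrightarrow> l1norm V \<le> c * l1norm (M *v V)"
proof -
  let ?E = "insert 1 {M $ i $ j | i j. M $ i $ j \<noteq> 0}"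
  have "{M $ i $ j | i j. M $ i $ j \<noteq> 0} \<subseteq> (\<lambda>(i, j). M $ i $ j) ` UNIV" by auto
  then have fin: "finite ?E" by (simp add: finite_subset)
  define e where "e = Min ?E"
  have "e \<in> ?E" unfolding e_def by (rule Min_in[OF fin]) simp
  then have e: "0 < e" using nonneg_matD[OF M] by (auto simp: less_le)
  have "l1norm V \<le> (L / e) * l1norm (M *v V)" if V: "balanced L V" and nz: "M *v V \<noteq> 0" for V
  proof -
    have V0: "nonneg_vec V" using V by (rule balanced_nonneg)
    obtain i where "i \<in> supp (M *v V)" using nz by (metis ex_in_conv supp_empty_iff)
    then obtain j where j: "V $ j \<noteq> 0" "M $ i $ j \<noteq> 0"
      by (auto simp: in_supp_mult_vec_iff[OF M V0] in_supp_iff[of _ V])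
    have "e \<le> M $ i $ j" unfolding e_def by (rule Min_le[OF fin]) (use j in auto)
    then have "e * V $ j \<le> M $ i $ j * V $ j" by (rule mult_right_mono[OF _ nonneg_vecD[OF V0]])
    also have "\<dots> \<le> l1norm (M *v V)"
      using term_le_mult_vec_nth[OF M V0, of i j] entry_le_l1norm[of "M *v V" i] by linarith
    finally have "V $ j \<le> l1norm (M *v V) / e" using e by (simp add: field_simps)
    then have "L * V $ j \<le> L * (l1norm (M *v V) / e)" using L by (intro mult_left_mono)
    then show ?thesis using balancedD[OF V j(1)] by simp
  qed
  then show ?thesis using that by blast
qed

lemma H2_mono: "M \<in> H2 K \<Longrightarrow> K \<le> K' \<Longrightarrow> M \<in> H2 K'"
  unfolding H2_def nonneg_mat_def
  by (smt (verit, ccfv_SIG) mem_Collect_eq mult_right_mono)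

lemma H1_iff:
  "M \<in> H1 \<longleftrightarrow> nonneg_mat M \<and>
     (\<forall>j j'. supp (column j M) \<subseteq> supp (column j' M) \<or> supp (column j' M) \<subseteq> supp (column j M))"
  by (auto simp: H1_def Delta_le_iff)

lemma H1_nonneg: "M \<in> H1 \<Longrightarrow> nonneg_mat M"
  by (simp add: H1_def)

lemma H3_nonneg: "M \<in> H3 l \<Longrightarrow> nonneg_mat M"
  by (simp add: H3_def)

lemma H3D:
  "M \<in> H3 l \<Longrightarrow> M $ i $ j \<noteq> 0 \<Longrightarrow> M $ i $ j' = 0 \<Longrightarrow> l1norm (column j' M) \<le> l * M $ i $ j"
  by (simp add: H3_def)

lemma H3_mono: "M \<in> H3 l \<Longrightarrow> l \<le> l' \<Longrightarrow> M \<in> H3 l'"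
  unfolding H3_def nonneg_mat_def
  by (smt (verit, ccfv_SIG) mem_Collect_eq mult_right_mono)

text \<open>The supports of the columns of \<open>M\<close> form a chain, so a union of some of them is the largest
  of them.\<close>

lemma supp_mult_vec_attained:
  fixes M :: "real ^ 'n ^ 'm"
  assumes M: "M \<in> H1" and V: "nonneg_vec V" "V \<noteq> 0"
  obtains j where "j \<in> supp V" "supp (M *v V) = supp (column j M)"
proof -
  let ?F = "(\<lambda>j. supp (column j M)) ` supp V"
  have "finite ?F" "?F \<noteq> {}" using V by (auto simp: supp_empty_iff)
  from finite_has_maximal[OF this] obtain S where S: "S \<in> ?F" "\<forall>T\<in>?F. S \<subseteq> T \<longrightarrow> S = T"
    by blast
  then obtain j where j: "j \<in> supp V" "S = supp (column j M)" by blast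
  have top: "supp (column l M) \<subseteq> S" if "l \<in> supp V" for l
    using S(2) that M j unfolding H1_iff by blast
  have "supp (M *v V) = S"
  proof (intro set_eqI iffI)
    fix i assume "i \<in> supp (M *v V)"
    then obtain l where "l \<in> supp V" "M $ i $ l \<noteq> 0"
      using in_supp_mult_vec_iff[OF H1_nonneg[OF M] V(1)] by blast
    then show "i \<in> S" using top[of l] by (auto simp: in_supp_iff column_nth)
  next
    fix i assume "i \<in> S"
    then have "M $ i $ j \<noteq> 0" using j by (simp add: in_supp_iff column_nth)
    then show "i \<in> supp (M *v V)"
      using j in_supp_mult_vec_iff[OF H1_nonneg[OF M] V(1)] by blast
  qed
  with j that show ?thesis by blast
qed

lemma H1_matrix_mult:
  fixes M :: "real ^ 'n ^ 'm" and N :: "real ^ 'p ^ 'n"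
  assumes M: "M \<in> H1" and N: "nonneg_mat N"
  shows "M ** N \<in> H1"
proof -
  have *: "supp (column j (M ** N)) = {} \<or> (\<exists>l. supp (column j (M ** N)) = supp (column l M))" for j
  proof (cases "column j N = 0")
    case True
    then show ?thesis by (simp add: column_matrix_mult supp_empty_iff)
  next
    case False
    then show ?thesis
      using supp_mult_vec_attained[OF M nonneg_column[OF N]] by (metis column_matrix_mult)
  qed
  show ?thesis
    unfolding H1_iff
  proof (intro conjI allI)
    show "nonneg_mat (M ** N)" by (rule nonneg_matrix_mult[OF H1_nonneg[OF M] N])
    fix j j'
    show "supp (column j (M ** N)) \<subseteq> supp (column j' (M ** N)) \<or>
          supp (column j' (M ** N)) \<subseteq> supp (column j (M ** N))"
      using *[of j] *[of j'] M unfolding H1_iff by (metis empty_subsetI)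
  qed
qed

text \<open>Fix \<open>i\<close> with \<open>(M V)(i) \<noteq> 0\<close> and \<open>j0\<close> in the support of \<open>V\<close> with \<open>M(i,j0) \<noteq> 0\<close>. A column of
  \<open>M\<close> that is nonzero at \<open>i\<close> is controlled by its own entry there, and a column that vanishes at \<open>i\<close>
  by \<open>M(i,j0)\<close>; the weight \<open>V(j0)\<close> of the latter is not small because \<open>V\<close> is balanced. The
  resulting constant depends on \<open>L\<close> only through \<open>l * L\<close>, so for \<open>l < 1\<close> it stays bounded under
  iteration.\<close>

lemma balanced_mult_vec:
  fixes M :: "real ^ 'n ^ 'm"
  assumes M2: "M \<in> H2 K" and M3: "M \<in> H3 l" and V: "balanced L V" and l: "0 \<le> l" and K: "0 \<le> K"
  shows "balanced (K + l * L) (M *v V)"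
proof -
  have M: "nonneg_mat M" and V0: "nonneg_vec V"
    using M3 V by (auto simp: H3_nonneg balanced_nonneg)
  have "l1norm (M *v V) \<le> (K + l * L) * (M *v V) $ i" if i: "i \<in> supp (M *v V)" for i
  proof -
    obtain j0 where j0: "V $ j0 \<noteq> 0" "M $ i $ j0 \<noteq> 0"
      using i in_supp_mult_vec_iff[OF M V0] by (auto simp: in_supp_iff)
    have "l1norm (M *v V) = (\<Sum>j\<in>UNIV. V $ j * l1norm (column j M))"
      by (rule l1norm_mult_vec[OF M V0])
    also have "\<dots> \<le> (\<Sum>j\<in>UNIV. K * (M $ i $ j * V $ j) + l * M $ i $ j0 * V $ j)"
    proof (rule sum_mono)
      fix j
      have "l1norm (column j M) \<le> K * M $ i $ j + l * M $ i $ j0"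
      proof (cases "M $ i $ j = 0")
        case True
        then show ?thesis using H3D[OF M3 j0(2) True] by simp
      next
        case False
        then have "l1norm (column j M) \<le> K * M $ i $ j" using M2 by (simp add: H2_def)
        moreover have "0 \<le> l * M $ i $ j0" using l nonneg_matD[OF M] by simp
        ultimately show ?thesis by simp
      qed
      then have "V $ j * l1norm (column j M) \<le> V $ j * (K * M $ i $ j + l * M $ i $ j0)"
        by (rule mult_left_mono[OF _ nonneg_vecD[OF V0]])
      then show "V $ j * l1norm (column j M) \<le> K * (M $ i $ j * V $ j) + l * M $ i $ j0 * V $ j"
        by (simp add: algebra_simps)
    qed
    also have "\<dots> = K * (M *v V) $ i + l * M $ i $ j0 * l1norm V"
      by (simp add: sum.distrib sum_distrib_left mult_vec_nth l1norm_nonneg_vec[OF V0])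
    also have "l * M $ i $ j0 * l1norm V \<le> l * M $ i $ j0 * (L * V $ j0)"
      using balancedD[OF V j0(1)] l nonneg_matD[OF M] by (intro mult_left_mono) auto
    also have "l * M $ i $ j0 * (L * V $ j0) = l * L * (M $ i $ j0 * V $ j0)" by simp
    also have "\<dots> \<le> l * L * (M *v V) $ i"
    proof (rule mult_left_mono[OF term_le_mult_vec_nth[OF M V0]])
      have "0 < V $ j0" using j0 nonneg_vecD[OF V0, of j0] by simp
      moreover have "0 \<le> L * V $ j0" using balancedD[OF V j0(1)] l1norm_ge_0[of V] by linarith
      ultimately have "0 \<le> L" by (simp add: zero_le_mult_iff)
      then show "0 \<le> l * L" using l by simp
    qed
    finally show ?thesis by (simp add: algebra_simps)
  qed
  then show ?thesis by (simp add: balanced_def nonneg_mult_vec[OF M V0])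
qed

lemma H2_matrix_mult:
  fixes M :: "real ^ 'n ^ 'm" and N :: "real ^ 'p ^ 'n"
  assumes "M \<in> H2 K" "M \<in> H3 l" "N \<in> H2 L" "0 \<le> l" "0 \<le> K"
  shows "M ** N \<in> H2 (K + l * L)"
  using assms by (auto simp: H2_iff column_matrix_mult nonneg_matrix_mult balanced_mult_vec)

text \<open>If \<open>(M N)(i,j) \<noteq> 0 = (M N)(i,j')\<close> then the two columns of \<open>N\<close> are themselves separated, at any
  index \<open>p\<close> through which the first of these entries is reached; so the factors \<open>l\<close> and \<open>l'\<close> are
  gained one after the other.\<close>

lemma H3_matrix_mult:
  fixes M :: "real ^ 'n ^ 'm" and N :: "real ^ 'p ^ 'n"
  assumes M: "M \<in> H3 l" and N: "N \<in> H3 l'" and l: "0 \<le> l" "0 \<le> l'"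
  shows "M ** N \<in> H3 (l * l')"
proof -
  have M0: "nonneg_mat M" and N0: "nonneg_mat N" using M N by (auto simp: H3_nonneg)
  have "l1norm (column j' (M ** N)) \<le> l * l' * (M ** N) $ i $ j"
    if ij: "(M ** N) $ i $ j \<noteq> 0" and ij': "(M ** N) $ i $ j' = 0" for i j j'
  proof -
    let ?V = "column j N" and ?W = "column j' N"
    have V: "nonneg_vec ?V" and W: "nonneg_vec ?W" using N0 by (auto intro: nonneg_column)
    have "i \<in> supp (M *v ?V)" "i \<notin> supp (M *v ?W)"
      using ij ij' by (auto simp: in_supp_iff column_nth simp flip: column_matrix_mult)
    then have reach: "\<exists>p. ?V $ p \<noteq> 0 \<and> M $ i $ p \<noteq> 0"
      and vanish: "?W $ q \<noteq> 0 \<Longrightarrow> M $ i $ q = 0" for q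
      unfolding in_supp_mult_vec_iff[OF M0 V] in_supp_mult_vec_iff[OF M0 W] by (auto simp: in_supp_iff)
    obtain p where p: "?V $ p \<noteq> 0" "M $ i $ p \<noteq> 0" using reach by blast
    have Wp: "?W $ p = 0" using p vanish by blast
    have "l1norm (M *v ?W) = (\<Sum>q\<in>UNIV. ?W $ q * l1norm (column q M))"
      by (rule l1norm_mult_vec[OF M0 W])
    also have "\<dots> \<le> (\<Sum>q\<in>UNIV. ?W $ q * (l * M $ i $ p))"
    proof (rule sum_mono)
      fix q
      show "?W $ q * l1norm (column q M) \<le> ?W $ q * (l * M $ i $ p)"
        using H3D[OF M p(2) vanish, of q] nonneg_vecD[OF W, of q]
        by (cases "?W $ q = 0") (auto intro: mult_left_mono)
    qed
    also have "\<dots> = l * M $ i $ p * l1norm ?W"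
      by (simp add: l1norm_nonneg_vec[OF W] sum_distrib_left mult_ac)
    also have "\<dots> \<le> l * M $ i $ p * (l' * ?V $ p)"
      using H3D[OF N, of p j j'] p Wp l nonneg_matD[OF M0]
      by (intro mult_left_mono) (auto simp: column_nth)
    also have "\<dots> = l * l' * (M $ i $ p * ?V $ p)" by simp
    also have "\<dots> \<le> l * l' * (M *v ?V) $ i"
      using l by (intro mult_left_mono term_le_mult_vec_nth M0 V) simp
    finally show ?thesis by (metis column_matrix_mult column_nth)
  qed
  then show ?thesis by (simp add: H3_def nonneg_matrix_mult[OF M0 N0])
qed

section \<open>Contraction of directions\<close>

definition direction :: "real ^ 'n \<Rightarrow> real ^ 'n" where
  "direction V = V /\<^sub>R l1norm V"

lemma direction_nth: "direction V $ i = V $ i / l1norm V"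
  by (simp add: direction_def divide_inverse)

lemma l1norm_direction: "V \<noteq> 0 \<Longrightarrow> l1norm (direction V) = 1"
  using l1norm_pos_iff[of V] by (simp add: direction_def l1norm_scaleR)

text \<open>On the support of \<open>V\<close> this confines the ratios \<open>W(i) / V(i)\<close> to the interval from \<open>a\<close> to \<open>b\<close>;
  without division it also covers the rows where \<open>V\<close> vanishes.\<close>

definition between :: "real \<Rightarrow> real \<Rightarrow> real ^ 'n \<Rightarrow> real ^ 'n \<Rightarrow> bool" where
  "between a b V W \<longleftrightarrow> (\<forall>i. a * V $ i \<le> W $ i \<and> W $ i \<le> b * V $ i)"

lemma l1norm_between:
  assumes "between a b V W" "nonneg_vec V" "nonneg_vec W"
  shows "a * l1norm V \<le> l1norm W" "l1norm W \<le> b * l1norm V"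
  using assms by (auto simp: between_def l1norm_nonneg_vec sum_distrib_left intro!: sum_mono)

lemma direction_diff_le:
  assumes VW: "between a b V W" and V: "nonneg_vec V" "V \<noteq> 0" and W: "nonneg_vec W" and a: "0 < a"
  shows "l1norm (direction W - direction V) \<le> (b - a) / a"
proof -
  let ?v = "l1norm V" and ?w = "l1norm W"
  have v: "0 < ?v" using V by (simp add: l1norm_pos_iff)
  note ab = l1norm_between[OF VW V(1) W]
  have w: "0 < ?w" using ab(1) a v by (smt (verit) mult_pos_pos)
  have "a * ?v \<le> b * ?v" using ab by linarith
  then have "a \<le> b" using v by simp
  have *: "\<bar>W $ i / ?w - V $ i / ?v\<bar> \<le> (b - a) / ?w * V $ i" for i
  proof -
    have Vi: "0 \<le> V $ i" by (rule nonneg_vecD[OF V(1)])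
    have "a * V $ i \<le> ?w / ?v * V $ i" "?w / ?v * V $ i \<le> b * V $ i"
      using ab v by (intro mult_right_mono[OF _ Vi]; simp add: pos_le_divide_eq pos_divide_le_eq)+
    moreover have "a * V $ i \<le> W $ i" "W $ i \<le> b * V $ i" using VW by (auto simp: between_def)
    ultimately have "\<bar>W $ i - ?w / ?v * V $ i\<bar> \<le> b * V $ i - a * V $ i" by linarith
    then have "\<bar>W $ i - ?w / ?v * V $ i\<bar> / ?w \<le> ((b - a) * V $ i) / ?w"
      using w by (intro divide_right_mono) (auto simp: algebra_simps)
    moreover have "\<bar>W $ i - ?w / ?v * V $ i\<bar> / ?w = \<bar>W $ i / ?w - V $ i / ?v\<bar>"
    proof -
      have "W $ i / ?w - V $ i / ?v = (W $ i - ?w / ?v * V $ i) / ?w"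
        using w by (simp add: diff_divide_distrib)
      then show ?thesis using w by (simp only: abs_divide abs_of_pos)
    qed
    ultimately show ?thesis by simp
  qed
  have "l1norm (direction W - direction V) = (\<Sum>i\<in>UNIV. \<bar>W $ i / ?w - V $ i / ?v\<bar>)"
    by (simp add: l1norm_def[of "direction W - direction V"] direction_nth)
  also have "\<dots> \<le> (\<Sum>i\<in>UNIV. (b - a) / ?w * V $ i)" by (rule sum_mono) (rule *)
  also have "\<dots> = (b - a) / ?w * ?v" by (simp add: l1norm_nonneg_vec[OF V(1)] sum_distrib_left)
  also have "\<dots> = (b - a) * (?v / ?w)" by simp
  also have "\<dots> \<le> (b - a) * (1 / a)"
    using ab(1) a w \<open>a \<le> b\<close> by (intro mult_left_mono) (auto simp: field_simps)
  finally show ?thesis by simp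
qed

text \<open>A column of \<open>M\<close> that does not have the maximal support among those selected by \<open>V\<close> is
  dominated, by \<open>H3\<close>, by one that has it. So the columns of maximal support carry a definite share
  of \<open>M V\<close>.\<close>

lemma maximal_columns_carry_mass:
  fixes M :: "real ^ 'n ^ 'm"
  assumes M1: "M \<in> H1" and M3: "M \<in> H3 l" and V: "balanced L V" "V \<noteq> 0"
    and l: "0 \<le> l"
  defines "G \<equiv> {j. supp (column j M) = supp (M *v V)}"
  shows "l1norm (M *v V) \<le> (1 + l * L) * (\<Sum>j\<in>G. V $ j * l1norm (column j M))"
proof -
  have M: "nonneg_mat M" and V0: "nonneg_vec V"
    using M1 V by (auto simp: H1_nonneg balanced_nonneg)
  let ?c = "\<lambda>j. V $ j * l1norm (column j M)"
  obtain j0 where j0: "j0 \<in> supp V" "supp (M *v V) = supp (column j0 M)"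
    using supp_mult_vec_attained[OF M1 V0 V(2)] .
  then have j0G: "j0 \<in> G" by (simp add: G_def)
  have Vj0: "V $ j0 \<noteq> 0" using j0 by (simp add: in_supp_iff)
  have c0: "0 \<le> ?c j" for j by (intro mult_nonneg_nonneg nonneg_vecD[OF V0] l1norm_ge_0)
  have bad: "?c j \<le> V $ j * (l * l1norm (column j0 M))" if j: "j \<in> - G" for j
  proof (cases "V $ j = 0")
    case False
    then have "supp (column j M) \<subseteq> supp (M *v V)"
      unfolding subset_iff in_supp_mult_vec_iff[OF M V0] by (auto simp: in_supp_iff column_nth)
    then obtain i where i: "i \<in> supp (M *v V)" "i \<notin> supp (column j M)"
      using j by (auto simp: G_def)
    have "M $ i $ j0 \<noteq> 0" "M $ i $ j = 0"
      using i j0(2) by (auto simp: in_supp_iff column_nth)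
    then have "l1norm (column j M) \<le> l * M $ i $ j0" by (rule H3D[OF M3])
    also have "\<dots> \<le> l * l1norm (column j0 M)"
      using l entry_le_l1norm[of "column j0 M" i] by (intro mult_left_mono) (auto simp: column_nth)
    finally show ?thesis by (rule mult_left_mono[OF _ nonneg_vecD[OF V0]])
  qed simp
  have "(\<Sum>j\<in>- G. ?c j) \<le> (\<Sum>j\<in>- G. V $ j * (l * l1norm (column j0 M)))"
    by (rule sum_mono) (rule bad)
  also have "\<dots> \<le> (\<Sum>j\<in>UNIV. V $ j * (l * l1norm (column j0 M)))"
    by (intro sum_mono2 mult_nonneg_nonneg nonneg_vecD[OF V0] l l1norm_ge_0) auto
  also have "\<dots> = l1norm V * (l * l1norm (column j0 M))"
    by (simp add: l1norm_nonneg_vec[OF V0] sum_distrib_right)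
  also have "\<dots> \<le> (L * V $ j0) * (l * l1norm (column j0 M))"
    by (intro mult_right_mono balancedD[OF V(1) Vj0] mult_nonneg_nonneg l l1norm_ge_0)
  also have "\<dots> = l * L * ?c j0" by simp
  also have "\<dots> \<le> l * L * (\<Sum>j\<in>G. ?c j)"
  proof (rule mult_left_mono)
    show "?c j0 \<le> (\<Sum>j\<in>G. ?c j)" using j0G c0 by (intro member_le_sum) auto
    have "0 < V $ j0" using Vj0 nonneg_vecD[OF V0, of j0] by simp
    moreover have "0 \<le> L * V $ j0" using balancedD[OF V(1) Vj0] l1norm_ge_0[of V] by linarith
    ultimately show "0 \<le> l * L" using l by (simp add: zero_le_mult_iff)
  qed
  finally have "(\<Sum>j\<in>- G. ?c j) \<le> l * L * (\<Sum>j\<in>G. ?c j)" .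
  moreover have "l1norm (M *v V) = (\<Sum>j\<in>G. ?c j) + (\<Sum>j\<in>- G. ?c j)"
    unfolding l1norm_mult_vec[OF M V0]
    by (subst sum.union_disjoint[symmetric]) (auto intro: sum.cong)
  ultimately show ?thesis by (simp add: algebra_simps)
qed

definition contraction_factor :: "real \<Rightarrow> real \<Rightarrow> real \<Rightarrow> real" where
  "contraction_factor K l L = 1 - 1 / (K * (1 + l * L))"

lemma contraction_factor_bounds:
  assumes "1 \<le> K" "0 \<le> l" "0 \<le> L"
  shows "0 \<le> contraction_factor K l L" "contraction_factor K l L < 1"
proof -
  have "1 * 1 \<le> K * (1 + l * L)" using assms by (intro mult_mono) auto
  then have "0 < 1 / (K * (1 + l * L))" "1 / (K * (1 + l * L)) \<le> 1" by simp_all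
  then show "0 \<le> contraction_factor K l L" "contraction_factor K l L < 1"
    unfolding contraction_factor_def by linarith+
qed

text \<open>A contraction in the manner of Doeblin. On the support of \<open>M V\<close> the ratio
  \<open>(M W)(i) / (M V)(i)\<close> is an average of the ratios \<open>W(j) / V(j)\<close>, with weights proportional to
  \<open>M(i,j) V(j)\<close>. By \<open>H2\<close>, a column of maximal support has comparable entries in all the rows \<open>i\<close> of that
  support, and such columns carry a definite share of the total mass; so the averages for different
  \<open>i\<close> have a common part of mass at least \<open>1 - contraction_factor K l L\<close>.\<close>

lemma between_mult_vec_contracts:
  fixes M :: "real ^ 'n ^ 'm"
  assumes M1: "M \<in> H1" and M2: "M \<in> H2 K" and M3: "M \<in> H3 l" and V: "balanced L V"
    and VW: "between a b V W" and W: "nonneg_vec W"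
    and ab: "a \<le> b" and K: "1 \<le> K" and l: "0 \<le> l" and L: "0 \<le> L"
  obtains a' b' where "a \<le> a'" "a' \<le> b'" "b' - a' \<le> contraction_factor K l L * (b - a)"
    "between a' b' (M *v V) (M *v W)"
proof (cases "M *v V = 0")
  case True
  have M: "nonneg_mat M" and V0: "nonneg_vec V"
    using M1 V by (auto simp: H1_nonneg balanced_nonneg)
  have zero: "M $ i $ j * W $ j = 0" for i j
  proof -
    have "M $ i $ j * V $ j = 0"
      using term_le_mult_vec_nth[OF M V0, of i j] True nonneg_matD[OF M, of i j] nonneg_vecD[OF V0, of j]
      by (metis antisym mult_nonneg_nonneg zero_index)
    moreover have "W $ j = 0" if "V $ j = 0"
      using VW that nonneg_vecD[OF W, of j] unfolding between_def by (metis antisym mult_zero_right)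
    ultimately show ?thesis by auto
  qed
  have "M *v W = 0" unfolding vec_eq_iff mult_vec_nth zero by simp
  then have "between a a (M *v V) (M *v W)" using True by (simp add: between_def)
  moreover have "a - a \<le> contraction_factor K l L * (b - a)"
    using contraction_factor_bounds(1)[OF K l L] ab by simp
  ultimately show ?thesis using that[of a a] by simp
next
  case False
  have M: "nonneg_mat M" and V0: "nonneg_vec V"
    using M1 V by (auto simp: H1_nonneg balanced_nonneg)
  let ?X = "M *v V"
  have X0: "nonneg_vec ?X" by (rule nonneg_mult_vec[OF M V0])
  have x: "0 < l1norm ?X" using False by (simp add: l1norm_pos_iff)
  define G where "G = {j. supp (column j M) = supp ?X}"
  (* The common part of the averages; it is applied to W - a V and to b V - W. *)
  have common: "(\<Sum>j\<in>G. U $ j * l1norm (column j M)) / K / l1norm ?X * ?X $ i \<le> (M *v U) $ i"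
    (is "?s / K / _ * _ \<le> _") if U: "nonneg_vec U" for U i
  proof (cases "?X $ i = 0")
    case True
    then show ?thesis using nonneg_vecD[OF nonneg_mult_vec[OF M U]] by simp
  next
    case False
    have s: "0 \<le> ?s" by (intro sum_nonneg mult_nonneg_nonneg nonneg_vecD[OF U] l1norm_ge_0)
    have "?s / K / l1norm ?X * ?X $ i = ?s / K * (?X $ i / l1norm ?X)" by simp
    also have "\<dots> \<le> ?s / K * 1"
      using s K x entry_le_l1norm[of ?X i] by (intro mult_left_mono) auto
    also have "\<dots> = (\<Sum>j\<in>G. U $ j * (l1norm (column j M) / K))" by (simp add: sum_divide_distrib)
    also have "\<dots> \<le> (\<Sum>j\<in>G. M $ i $ j * U $ j)"
    proof (rule sum_mono)
      fix j assume "j \<in> G"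
      then have "M $ i $ j \<noteq> 0" using False by (auto simp: G_def set_eq_iff in_supp_iff column_nth)
      then have "l1norm (column j M) \<le> K * M $ i $ j" using M2 by (simp add: H2_def)
      then have "l1norm (column j M) / K \<le> M $ i $ j" using K by (simp add: field_simps)
      then show "U $ j * (l1norm (column j M) / K) \<le> M $ i $ j * U $ j"
        using nonneg_vecD[OF U, of j] by (subst mult.commute) (rule mult_right_mono)
    qed
    also have "\<dots> \<le> (M *v U) $ i"
      unfolding mult_vec_nth by (intro sum_mono2 mult_nonneg_nonneg nonneg_vecD[OF U] nonneg_matD[OF M]) auto
    finally show ?thesis .
  qed
  let ?low = "W - a *\<^sub>R V" and ?up = "b *\<^sub>R V - W"
  have low: "nonneg_vec ?low" and up: "nonneg_vec ?up" using VW by (auto simp: between_def nonneg_vec_def)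
  define p where "p = (\<Sum>j\<in>G. ?low $ j * l1norm (column j M)) / K / l1norm ?X"
  define q where "q = (\<Sum>j\<in>G. ?up $ j * l1norm (column j M)) / K / l1norm ?X"
  have p0: "0 \<le> p" unfolding p_def
    using K by (intro divide_nonneg_pos x sum_nonneg mult_nonneg_nonneg nonneg_vecD[OF low] l1norm_ge_0) auto
  have lowM: "(M *v ?low) $ i = (M *v W) $ i - a * ?X $ i" for i
    by (simp add: mult_vec_nth sum_subtractf sum_distrib_left algebra_simps)
  have upM: "(M *v ?up) $ i = b * ?X $ i - (M *v W) $ i" for i
    by (simp add: mult_vec_nth sum_subtractf sum_distrib_left algebra_simps)
  have btw: "between (a + p) (b - q) ?X (M *v W)"
    using common[OF low] common[OF up] unfolding between_def lowM upM p_def[symmetric] q_def[symmetric]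
    by (simp add: algebra_simps)
  have "p + q = ((\<Sum>j\<in>G. ?low $ j * l1norm (column j M)) + (\<Sum>j\<in>G. ?up $ j * l1norm (column j M)))
      / K / l1norm ?X"
    unfolding p_def q_def by (simp add: add_divide_distrib)
  also have "(\<Sum>j\<in>G. ?low $ j * l1norm (column j M)) + (\<Sum>j\<in>G. ?up $ j * l1norm (column j M))
      = (b - a) * (\<Sum>j\<in>G. V $ j * l1norm (column j M))"
    unfolding sum.distrib[symmetric] sum_distrib_left by (rule sum.cong) (auto simp: algebra_simps)
  finally have pq: "p + q = (b - a) * (\<Sum>j\<in>G. V $ j * l1norm (column j M)) / K / l1norm ?X" .
  have "V \<noteq> 0" using False by auto
  from maximal_columns_carry_mass[OF M1 M3 V this l]
  have mass: "l1norm ?X \<le> (1 + l * L) * (\<Sum>j\<in>G. V $ j * l1norm (column j M))"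
    unfolding G_def .
  have "1 + l * L > 0" using l L by (simp add: add_pos_nonneg)
  then have "l1norm ?X / (1 + l * L) \<le> (\<Sum>j\<in>G. V $ j * l1norm (column j M))"
    using mass by (simp add: pos_divide_le_eq mult.commute)
  then have "l1norm ?X / (1 + l * L) / K / l1norm ?X
      \<le> (\<Sum>j\<in>G. V $ j * l1norm (column j M)) / K / l1norm ?X"
    using x K by (intro divide_right_mono) auto
  then have "1 / (K * (1 + l * L)) \<le> (\<Sum>j\<in>G. V $ j * l1norm (column j M)) / K / l1norm ?X"
    using x by (simp add: mult.commute)
  then have "(b - a) * (1 / (K * (1 + l * L)))
      \<le> (b - a) * ((\<Sum>j\<in>G. V $ j * l1norm (column j M)) / K / l1norm ?X)"
    using ab by (intro mult_left_mono) auto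
  then have "(b - a) * (1 / (K * (1 + l * L))) \<le> p + q"
    unfolding pq by (simp only: times_divide_eq_right)
  then have contr: "(b - q) - (a + p) \<le> contraction_factor K l L * (b - a)"
    by (simp add: contraction_factor_def algebra_simps)
  have "(a + p) * l1norm ?X \<le> (b - q) * l1norm ?X"
    using l1norm_between[OF btw X0 nonneg_mult_vec[OF M W]] by linarith
  then have "a + p \<le> b - q" using x by simp
  with p0 contr btw show ?thesis using that[of "a + p" "b - q"] by simp
qed

section \<open>Products along the blocks\<close>

lemma foldr_matrix_mult: "foldr (\<lambda>k M. A k ** M) ks N = foldr (\<lambda>k M. A k ** M) ks (mat 1) ** N"
  for A :: "nat \<Rightarrow> real ^ 'd ^ 'd"
  by (induction ks) (simp_all add: matrix_mul_assoc)

lemma mat_prod_split: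
  assumes "m \<le> n" "n \<le> p"
  shows "mat_prod A m p = mat_prod A m n ** mat_prod A n p"
proof -
  have "[Suc m..<Suc p] = [Suc m..<Suc n] @ [Suc n..<Suc p]"
    using assms upt_add_eq_append[of "Suc m" "Suc n" "p - n"] by simp
  then show ?thesis
    by (simp add: mat_prod_def foldr_matrix_mult[of A "[Suc m..<Suc n]" "foldr _ _ _"] del: upt_Suc)
qed

lemma nonneg_mat_prod:
  assumes "\<forall>n\<ge>1. nonneg_mat (A n)"
  shows "nonneg_mat (mat_prod A m n)"
proof -
  have "nonneg_mat (foldr (\<lambda>k M. A k ** M) ks (mat 1))" if "\<forall>k\<in>set ks. 1 \<le> k" for ks
    using that
  proof (induction ks)
    case Nil
    then show ?case by (simp add: nonneg_mat_def mat_def)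
  next
    case (Cons k ks)
    then show ?case using assms by (auto intro: nonneg_matrix_mult)
  qed
  then show ?thesis by (simp add: mat_prod_def del: upt_Suc)
qed

locale block_products =
  fixes A :: "nat \<Rightarrow> real ^ 'd ^ 'd" and lam \<Lambda> :: real and s :: "nat \<Rightarrow> nat"
  assumes nonneg_A: "\<forall>n\<ge>1. nonneg_mat (A n)"
    and condC: "condition_C A lam \<Lambda> s"
    and P_nonzero: "\<forall>n\<ge>1. P A n \<noteq> 0"
begin

lemma lam: "0 \<le> lam" "lam < 1" and Lam: "1 \<le> \<Lambda>" and block_seq: "block_seq s"
  and Q_H: "s 2 \<le> n \<Longrightarrow> Q A s n \<in> H1 \<and> Q A s n \<in> H2 \<Lambda> \<and> Q A s n \<in> H3 lam"
  using condC by (auto simp: condition_C_def)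

lemma s_less: "1 \<le> k \<Longrightarrow> s k < s (Suc k)"
  using block_seq by (simp add: block_seq_def)

lemma s_one: "s 1 = 0" "s (Suc 0) = 0"
  using block_seq by (simp_all add: block_seq_def)

lemma s_mono: "j \<le> k \<Longrightarrow> s j \<le> s k"
proof (induction k rule: dec_induct)
  case (step k)
  have "s k \<le> s (Suc k)"
    using s_less[of k] s_one block_seq
    by (cases "k = 0") (simp_all add: block_seq_def Suc_le_eq less_imp_le)
  then show ?case using step by simp
qed simp

lemma block_index_bounds: "s (block_index s n + 1) \<le> n" "n < s (block_index s n + 2)"
  using theI'[OF block_index_unique[OF block_seq, of n]] by (auto simp: block_index_def)

lemma block_index_eqI: "s (k + 1) \<le> n \<Longrightarrow> n < s (k + 2) \<Longrightarrow> block_index s n = k"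
  using block_index_unique[OF block_seq, of n] block_index_bounds[of n] by blast

lemma block_index_ge: "s (k + 1) \<le> n \<Longrightarrow> k \<le> block_index s n"
  using s_mono[of "block_index s n + 2" "k + 1"] block_index_bounds[of n] by fastforce

definition bal :: real where "bal = \<Lambda> / (1 - lam)"

text \<open>The fixed point of the recursion for the constants in \<open>balanced_mult_vec\<close>.\<close>

lemma bal_fixed: "\<Lambda> + lam * bal = bal"
  using lam by (simp add: bal_def field_simps)

lemma bal_ge: "\<Lambda> \<le> bal" "1 \<le> bal" "0 \<le> bal"
proof -
  show *: "\<Lambda> \<le> bal" using lam Lam by (simp add: bal_def field_simps)
  show "1 \<le> bal" "0 \<le> bal" using * Lam by auto
qed

text \<open>For \<open>s k \<le> n\<close> one has \<open>P A n = head k ** tail k n\<close>. The tail decides to which class a column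
  belongs; the head then makes the directions within a class agree.\<close>

definition tail :: "nat \<Rightarrow> nat \<Rightarrow> real ^ 'd ^ 'd" where
  "tail k n = mat_prod A (s k) n"

definition head :: "nat \<Rightarrow> real ^ 'd ^ 'd" where
  "head k = P A (s k)"

lemma nonneg_tail: "nonneg_mat (tail k n)"
  by (simp add: tail_def nonneg_mat_prod nonneg_A)

lemma nonneg_P: "nonneg_mat (P A n)"
  by (simp add: P_def nonneg_mat_prod nonneg_A)

lemma nonneg_head: "nonneg_mat (head k)"
  by (simp add: head_def nonneg_P)

lemma P_eq_tail: "P A n = tail 1 n"
  by (simp add: P_def tail_def s_one)

lemma P_split: "s k \<le> n \<Longrightarrow> P A n = head k ** tail k n"
  unfolding P_def head_def tail_def by (rule mat_prod_split) auto

lemma column_P: "s k \<le> n \<Longrightarrow> column j (P A n) = head k *v column j (tail k n)"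
  by (simp add: P_split column_matrix_mult)

lemma tail_split: "s k \<le> n \<Longrightarrow> n \<le> p \<Longrightarrow> tail k p = tail k n ** mat_prod A n p"
  unfolding tail_def by (rule mat_prod_split)

lemma tail_split_block: "1 \<le> k \<Longrightarrow> s k \<le> s m \<Longrightarrow> s m \<le> n \<Longrightarrow> tail k n = tail k (s m) ** tail m n"
  unfolding tail_def by (rule mat_prod_split)

text \<open>The tail that starts with the last complete block is one of the matrices in condition C.\<close>

lemma tail_last_block_H:
  assumes "1 \<le> k" "s (k + 1) \<le> n" "n < s (k + 2)"
  shows "tail k n \<in> H1" "tail k n \<in> H2 \<Lambda>" "tail k n \<in> H3 lam"
proof -
  have "s 2 \<le> n" using assms s_mono[of 2 "k + 1"] by simp
  moreover have "tail k n = Q A s n" using block_index_eqI[OF assms(2,3)] by (simp add: tail_def Q_def)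
  ultimately show "tail k n \<in> H1" "tail k n \<in> H2 \<Lambda>" "tail k n \<in> H3 lam" using Q_H by auto
qed

lemma block_H:
  assumes "1 \<le> k"
  shows "tail k (s (Suc k)) \<in> H1" "tail k (s (Suc k)) \<in> H2 \<Lambda>" "tail k (s (Suc k)) \<in> H3 lam"
  using tail_last_block_H[OF assms, of "s (Suc k)"] s_less[of "Suc k"] by auto

text \<open>Prepending one block to a tail keeps the balance constant at \<open>bal\<close>, by \<open>bal_fixed\<close>, and gains one
  more factor \<open>lam\<close> in \<open>H3\<close>.\<close>

lemma tail_H_aux:
  assumes K: "s (K + 1) \<le> n" "n < s (K + 2)" and k: "1 \<le> k" "k \<le> K"
  shows "tail k n \<in> H1 \<and> tail k n \<in> H2 bal \<and> tail k n \<in> H3 (lam ^ (Suc K - k))"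
  using k(2,1)
proof (induction k rule: inc_induct)
  case base
  then show ?case using tail_last_block_H[OF _ K] H2_mono[OF _ bal_ge(1)] by simp
next
  case (step k)
  let ?B = "tail k (s (Suc k))" and ?T = "tail (Suc k) n"
  have split: "tail k n = ?B ** ?T"
    using step K s_mono[of k "Suc k"] s_mono[of "Suc k" "K + 1"] by (intro tail_split_block) auto
  have T: "?T \<in> H1" "?T \<in> H2 bal" "?T \<in> H3 (lam ^ (K - k))" using step by auto
  have B: "?B \<in> H1" "?B \<in> H2 \<Lambda>" "?B \<in> H3 lam" using block_H step by auto
  have "?B ** ?T \<in> H2 (\<Lambda> + lam * bal)"
    using B T lam Lam by (intro H2_matrix_mult) auto
  moreover have "?B ** ?T \<in> H3 (lam * lam ^ (K - k))"
    using B T lam by (intro H3_matrix_mult) auto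
  moreover have "?B ** ?T \<in> H1" by (intro H1_matrix_mult B nonneg_tail)
  moreover have "lam * lam ^ (K - k) = lam ^ (Suc K - k)"
    using step by (simp add: Suc_diff_le)
  ultimately show ?case by (simp add: split bal_fixed)
qed

lemma tail_H:
  assumes "1 \<le> k" "s (Suc k) \<le> n"
  shows "tail k n \<in> H1" "tail k n \<in> H2 bal"
  using tail_H_aux[OF block_index_bounds assms(1)] block_index_ge[of k n] assms by auto

lemma tail_H3:
  assumes k: "1 \<le> k" and n: "s (k + r) \<le> n" and r: "1 \<le> r"
  shows "tail k n \<in> H3 (lam ^ r)"
proof -
  let ?K = "block_index s n"
  have "k + r - 1 \<le> ?K" using block_index_ge[of "k + r - 1" n] n r by simp
  then have *: "r \<le> Suc ?K - k" "k \<le> ?K" using r by auto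
  have "tail k n \<in> H3 (lam ^ (Suc ?K - k))"
    using tail_H_aux[OF block_index_bounds k *(2)] by blast
  then show ?thesis using * lam by (elim H3_mono) (intro power_decreasing, auto)
qed

lemma balanced_column_tail: "1 \<le> k \<Longrightarrow> s (Suc k) \<le> n \<Longrightarrow> balanced bal (column j (tail k n))"
  using tail_H(2) by (auto simp: H2_iff)

definition rate :: real where "rate = contraction_factor \<Lambda> lam bal"

lemma rate: "0 \<le> rate" "rate < 1"
  using contraction_factor_bounds[OF Lam lam(1) bal_ge(3)] by (auto simp: rate_def)

lemma head_contracts:
  assumes "1 \<le> k" and "balanced bal V" and "nonneg_vec W" and "between a b V W" and "a \<le> b"
  shows "\<exists>a' b'. a \<le> a' \<and> a' \<le> b' \<and> b' - a' \<le> rate ^ (k - 1) * (b - a) \<and>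
    between a' b' (head k *v V) (head k *v W)"
  using assms
proof (induction k arbitrary: V W a b rule: dec_induct)
  case base
  have "head 1 *v U = U" for U :: "real ^ 'd"
    by (simp add: head_def s_one P_def mat_prod_def)
  then show ?case using base by auto
next
  case (step k)
  let ?B = "tail k (s (Suc k))"
  have k: "1 \<le> k" using step by simp
  note B = block_H[OF k]
  have head: "head (Suc k) *v U = head k *v (?B *v U)" for U
  proof -
    have "head (Suc k) = head k ** ?B"
      unfolding head_def[of "Suc k"] using s_mono[of k "Suc k"] by (intro P_split) simp
    then show ?thesis by (simp add: matrix_vector_mul_assoc)
  qed
  obtain a1 b1 where 1: "a \<le> a1" "a1 \<le> b1" "b1 - a1 \<le> rate * (b - a)" "between a1 b1 (?B *v V) (?B *v W)"
    using between_mult_vec_contracts[OF B step.prems(1,3,2,4) Lam lam(1) bal_ge(3)] unfolding rate_def .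
  have "balanced (\<Lambda> + lam * bal) (?B *v V)"
    using B step.prems lam Lam by (intro balanced_mult_vec) auto
  then have "balanced bal (?B *v V)" by (simp add: bal_fixed)
  from step.IH[OF this nonneg_mult_vec[OF nonneg_tail step.prems(2)] 1(4,2)]
  obtain a2 b2 where 2: "a1 \<le> a2" "a2 \<le> b2" "b2 - a2 \<le> rate ^ (k - 1) * (b1 - a1)"
    "between a2 b2 (head k *v (?B *v V)) (head k *v (?B *v W))" by blast
  have "rate ^ (k - 1) * (b1 - a1) \<le> rate ^ (k - 1) * (rate * (b - a))"
    using 1(3) rate by (intro mult_left_mono) auto
  also have "\<dots> = rate ^ (Suc k - 1) * (b - a)"
    using k by (cases k) auto
  finally show ?case using 1 2 unfolding head by (intro exI[of _ a2] exI[of _ b2]) auto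
qed

text \<open>The direction of \<open>head k *v V\<close> is determined by the support of \<open>V\<close>, up to an error that decays
  geometrically in \<open>k\<close>: two balanced vectors with the same support have bounded ratios.\<close>

lemma head_direction_diff:
  assumes k: "1 \<le> k" and V: "balanced bal V" and W: "balanced bal W" and supp: "supp V = supp W"
    and nz: "head k *v V \<noteq> 0"
  shows "l1norm (direction (head k *v W) - direction (head k *v V)) \<le> rate ^ (k - 1) * bal\<^sup>2"
proof -
  let ?v = "l1norm V" and ?w = "l1norm W"
  have V0: "nonneg_vec V" and W0: "nonneg_vec W" using V W by (auto simp: balanced_nonneg)
  have "V \<noteq> 0" using nz by auto
  moreover then have "W \<noteq> 0" using supp by (metis supp_empty_iff)
  ultimately have v: "0 < ?v" and w: "0 < ?w" by (auto simp: l1norm_pos_iff)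
  have L: "0 < bal" using bal_ge by simp
  (* An entry in the support lies between l1norm / bal and l1norm, for V and for W. *)
  define a where "a = ?w / (bal * ?v)"
  define b where "b = bal * ?w / ?v"
  have a: "0 < a" using v w L by (simp add: a_def)
  have "a * V $ i \<le> W $ i \<and> W $ i \<le> b * V $ i" for i
  proof (cases "V $ i = 0")
    case True
    then have "W $ i = 0" using supp by (metis in_supp_iff)
    then show ?thesis using True by simp
  next
    case False
    then have Wi: "W $ i \<noteq> 0" using supp by (metis in_supp_iff)
    have "a * V $ i = ?w * V $ i / (bal * ?v)" by (simp add: a_def)
    also have "\<dots> \<le> ?w * ?v / (bal * ?v)"
      using v w L entry_le_l1norm[of V i] by (intro divide_right_mono mult_left_mono) auto
    also have "\<dots> = ?w / bal" using v by simp
    also have "\<dots> \<le> W $ i" using balancedD[OF W Wi] L by (simp add: pos_divide_le_eq mult.commute)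
    finally have 1: "a * V $ i \<le> W $ i" .
    have "W $ i * ?v \<le> ?w * (bal * V $ i)"
      using entry_le_l1norm[of W i] balancedD[OF V False] v w by (intro mult_mono) auto
    then have "W $ i \<le> b * V $ i" using v by (simp add: b_def pos_le_divide_eq mult_ac)
    with 1 show ?thesis by simp
  qed
  then have btw: "between a b V W" by (simp add: between_def)
  have ba: "b = bal\<^sup>2 * a" using L by (simp add: a_def b_def power2_eq_square)
  have "1 \<le> bal\<^sup>2" using bal_ge by simp
  then have ab: "a \<le> b" using a by (simp add: ba)
  obtain a' b' where 1: "a \<le> a'" "a' \<le> b'" "b' - a' \<le> rate ^ (k - 1) * (b - a)"
    "between a' b' (head k *v V) (head k *v W)"
    using head_contracts[OF k V W0 btw ab] by blast
  have a': "0 < a'" using a 1 by simp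
  have "l1norm (direction (head k *v W) - direction (head k *v V)) \<le> (b' - a') / a'"
    using 1(4) nz a' by (intro direction_diff_le nonneg_mult_vec nonneg_head V0 W0)
  also have "\<dots> \<le> (b' - a') / a" using 1 a by (intro divide_left_mono) auto
  also have "\<dots> \<le> rate ^ (k - 1) * (b - a) / a" using 1 a by (intro divide_right_mono) auto
  also have "\<dots> \<le> rate ^ (k - 1) * b / a"
    using a rate by (intro divide_right_mono mult_left_mono) auto
  also have "\<dots> = rate ^ (k - 1) * bal\<^sup>2" using a by (simp add: ba)
  finally show ?thesis .
qed

section \<open>Classes of columns\<close>

definition live :: "nat \<Rightarrow> 'd set" where
  "live n = {j. column j (P A n) \<noteq> 0}"

definition column_supports :: "nat \<Rightarrow> nat \<Rightarrow> 'd set set" where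
  "column_supports k n = (\<lambda>j. supp (column j (tail k n))) ` live n"

lemma live_nonempty: "1 \<le> n \<Longrightarrow> live n \<noteq> {}"
proof -
  assume "1 \<le> n"
  then have "P A n \<noteq> 0" using P_nonzero by simp
  then show ?thesis by (auto simp: live_def vec_eq_iff column_nth)
qed

lemma s_Suc_pos: "1 \<le> k \<Longrightarrow> 1 \<le> s (Suc k)"
  using s_less[of k] by simp

text \<open>A column of \<open>tail k n'\<close> is a combination of columns of \<open>tail k n\<close>, whose supports form a chain;
  so no new supports appear as \<open>n\<close> grows.\<close>

lemma column_supports_antimono:
  assumes k: "1 \<le> k" and n: "s (Suc k) \<le> n" "n \<le> n'"
  shows "column_supports k n' \<subseteq> column_supports k n"
proof
  fix S assume "S \<in> column_supports k n'"
  then obtain j where j: "S = supp (column j (tail k n'))" "column j (P A n') \<noteq> 0"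
    by (auto simp: column_supports_def live_def)
  have sk: "s k \<le> n" using n s_mono[of k "Suc k"] by simp
  let ?R = "mat_prod A n n'"
  have col: "column j (tail k n') = tail k n *v column j ?R"
    using tail_split[OF sk n(2)] by (simp add: column_matrix_mult)
  have R: "nonneg_vec (column j ?R)" by (intro nonneg_column nonneg_mat_prod nonneg_A)
  have "column j ?R \<noteq> 0" using j(2) sk n(2) by (auto simp: column_P[of k n'] col)
  from supp_mult_vec_attained[OF tail_H(1)[OF k n(1)] R this] obtain j0
    where j0: "supp (tail k n *v column j ?R) = supp (column j0 (tail k n))" .
  have "supp (head k *v column j0 (tail k n)) = supp (head k *v column j (tail k n'))"
    using j0 col by (intro supp_mult_vec_cong nonneg_head nonneg_column nonneg_tail) simp
  then have "column j0 (P A n) \<noteq> 0"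
    using j(2) sk n(2) by (metis column_P le_trans supp_empty_iff)
  then show "S \<in> column_supports k n" using j0 col j(1) by (auto simp: column_supports_def live_def)
qed

lemma column_supports_settle:
  assumes k: "1 \<le> k"
  shows "\<exists>N\<ge>s (Suc k). \<forall>n\<ge>N. column_supports k n = column_supports k N"
proof -
  from ex_has_least_nat[where P = "\<lambda>n. s (Suc k) \<le> n" and m = "\<lambda>n. card (column_supports k n)", OF order_refl]
  obtain N where N: "s (Suc k) \<le> N" "\<And>n. s (Suc k) \<le> n \<Longrightarrow> card (column_supports k N) \<le> card (column_supports k n)"
    by blast
  have "column_supports k n = column_supports k N" if "N \<le> n" for n
    using column_supports_antimono[OF k N(1) that] N that
    by (intro card_subset_eq card_seteq) (auto simp: column_supports_def)
  with N(1) show ?thesis by blast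
qed

definition settled :: "nat \<Rightarrow> nat" where
  "settled k = (SOME N. s (Suc k) \<le> N \<and> (\<forall>n\<ge>N. column_supports k n = column_supports k N))"

definition level_supports :: "nat \<Rightarrow> 'd set set" where
  "level_supports k = column_supports k (settled k)"

lemma settled:
  assumes "1 \<le> k"
  shows "s (Suc k) \<le> settled k" "settled k \<le> n \<Longrightarrow> column_supports k n = level_supports k"
  using someI_ex[OF column_supports_settle[OF assms, unfolded Bex_def]]
  unfolding settled_def[symmetric] level_supports_def by blast+

lemma finite_level_supports: "finite (level_supports k)"
  by (simp add: level_supports_def column_supports_def)

lemma card_level_supports: "card (level_supports k) \<le> CARD('d)"
proof -
  have "card (level_supports k) \<le> card (live (settled k))"
    unfolding level_supports_def column_supports_def by (rule card_image_le) simp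
  also have "\<dots> \<le> CARD('d)" by (rule card_mono) auto
  finally show ?thesis .
qed

lemma level_supports_nonempty: "1 \<le> k \<Longrightarrow> level_supports k \<noteq> {}"
  unfolding level_supports_def column_supports_def
  using live_nonempty[of "settled k"] settled(1)[of k] s_Suc_pos[of k] by force

lemma level_supports_chain:
  assumes "1 \<le> k" "S \<in> level_supports k" "T \<in> level_supports k"
  shows "S \<subseteq> T \<or> T \<subseteq> S"
  using tail_H(1)[OF assms(1) settled(1)[OF assms(1)]] assms(2,3)
  by (auto simp: level_supports_def column_supports_def H1_iff)

lemma supp_column_tail:
  assumes "1 \<le> m" "m \<le> k" "s k \<le> n"
  shows "supp (column j (tail m n)) = image_support (tail m (s k)) (supp (column j (tail k n)))"
  using tail_split_block[OF assms(1) s_mono[OF assms(2)] assms(3)]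
  by (simp add: column_matrix_mult supp_mult_vec_eq_image_support nonneg_tail nonneg_column)

lemma level_supports_image:
  assumes m: "1 \<le> m" "m \<le> k"
  shows "level_supports m = image_support (tail m (s k)) ` level_supports k"
proof -
  have k: "1 \<le> k" using m by simp
  define n where "n = max (settled m) (settled k)"
  have n: "settled m \<le> n" "settled k \<le> n" by (auto simp: n_def)
  have "s k \<le> n" using n(2) settled(1)[OF k] s_mono[of k "Suc k"] by simp
  then show ?thesis
    unfolding settled(2)[OF m(1) n(1), symmetric] settled(2)[OF k n(2), symmetric] column_supports_def
    by (simp add: image_image supp_column_tail[OF m])
qed

text \<open>The supports at a lower level are the images of those at a higher level. So their number at level \<open>k\<close>
  is nondecreasing in \<open>k\<close>, and it is bounded; from the level where it is maximal, passing to a higher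
  level does not split the classes of columns any further.\<close>

definition top_level :: nat where
  "top_level = (SOME m. 1 \<le> m \<and> (\<forall>k\<ge>1. card (level_supports k) \<le> card (level_supports m)))"

lemma top_level:
  "1 \<le> top_level" "1 \<le> k \<Longrightarrow> card (level_supports k) \<le> card (level_supports top_level)"
proof -
  have "\<exists>m\<ge>1. \<forall>k. 1 \<le> k \<longrightarrow> card (level_supports k) \<le> card (level_supports m)"
    using ex_has_greatest_nat[where P = "\<lambda>k. 1 \<le> k" and k = 1 and b = "CARD('d) + 1"
        and f = "\<lambda>k. card (level_supports k)"] card_level_supports
    by (metis le_imp_less_Suc order_refl Suc_eq_plus1 less_imp_le)
  from someI_ex[OF this[unfolded Bex_def]]
  show "1 \<le> top_level" "1 \<le> k \<Longrightarrow> card (level_supports k) \<le> card (level_supports top_level)"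
    unfolding top_level_def[symmetric] by blast+
qed

lemma image_support_inj:
  assumes "top_level \<le> k"
  shows "inj_on (image_support (tail top_level (s k))) (level_supports k)"
proof (rule eq_card_imp_inj_on[OF finite_level_supports])
  show "card (image_support (tail top_level (s k)) ` level_supports k) = card (level_supports k)"
    using level_supports_image[OF top_level(1) assms] top_level assms
      card_image_le[OF finite_level_supports, of "image_support (tail top_level (s k))" k]
    by (intro antisym) auto
qed

text \<open>The classes are labelled by the supports at the top level, which form a chain; the columns of
  a class dominate those of the classes with smaller labels.\<close>

definition column_class :: "'d set \<Rightarrow> nat \<Rightarrow> 'd set" where
  "column_class S n = {j \<in> live n. supp (column j (tail top_level n)) = S}"

lemma live_in_class:
  assumes "settled top_level \<le> n" "j \<in> live n"
  shows "\<exists>S\<in>level_supports top_level. j \<in> column_class S n"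
  using assms settled(2)[OF top_level(1) assms(1)] by (auto simp: column_class_def column_supports_def)

lemma column_class_nonempty:
  assumes "settled top_level \<le> n" "S \<in> level_supports top_level"
  shows "column_class S n \<noteq> {}"
  using assms(2) unfolding settled(2)[OF top_level(1) assms(1), symmetric] by (auto simp: column_class_def column_supports_def)

lemma settled_ge_s: "1 \<le> k \<Longrightarrow> settled k \<le> n \<Longrightarrow> s k \<le> n"
  using settled(1)[of k] s_mono[of k "Suc k"] by simp

text \<open>Membership in a class is read off at the top level, but since no splitting occurs above it, the
  members of a class still have the same support at a higher level \<open>k\<close>, even for different ranks
  \<open>n\<close> and \<open>n'\<close>, once these are large in terms of \<open>k\<close>. This makes the error \<open>err k\<close> below arbitrarily small.\<close>

lemma column_class_same_support:
  assumes k: "top_level \<le> k" and n: "settled k \<le> n" "settled k \<le> n'"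
    and j: "j \<in> column_class S n" "j' \<in> column_class S n'"
  shows "supp (column j (tail k n)) = supp (column j' (tail k n'))"
proof (rule inj_onD[OF image_support_inj[OF k]])
  have k1: "1 \<le> k" using k top_level(1) by simp
  show "supp (column j (tail k n)) \<in> level_supports k"
    using j(1) unfolding settled(2)[OF k1 n(1), symmetric] by (auto simp: column_class_def column_supports_def)
  show "supp (column j' (tail k n')) \<in> level_supports k"
    using j(2) unfolding settled(2)[OF k1 n(2), symmetric] by (auto simp: column_class_def column_supports_def)
  show "image_support (tail top_level (s k)) (supp (column j (tail k n))) =
        image_support (tail top_level (s k)) (supp (column j' (tail k n')))"
    using j unfolding column_class_def
    by (simp add: supp_column_tail[OF top_level(1) k, symmetric] settled_ge_s[OF k1] n)
qed

definition err :: "nat \<Rightarrow> real" where "err k = rate ^ (k - 1) * bal\<^sup>2"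

lemma err_small:
  assumes "0 < e"
  shows "\<exists>k\<ge>top_level. err k < e"
proof -
  have "(\<lambda>k. rate ^ k * bal\<^sup>2) \<longlonglongrightarrow> 0"
    using rate by (intro tendsto_mult_left_zero LIMSEQ_realpow_zero)
  from order_tendstoD(2)[OF this assms] obtain k0 where "\<And>k. k0 \<le> k \<Longrightarrow> rate ^ k * bal\<^sup>2 < e"
    by (auto simp: eventually_sequentially)
  then have "err (Suc (max k0 top_level)) < e" by (simp add: err_def)
  then show ?thesis by (intro exI[of _ "Suc (max k0 top_level)"]) auto
qed

abbreviation column_dir :: "'d \<Rightarrow> nat \<Rightarrow> real ^ 'd" where
  "column_dir j n \<equiv> direction (column j (P A n))"

lemma column_dir_diff:
  assumes k: "top_level \<le> k" and n: "settled k \<le> n" "settled k \<le> n'"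
    and j: "j \<in> column_class S n" "j' \<in> column_class S n'"
  shows "l1norm (column_dir j' n' - column_dir j n) \<le> err k"
proof -
  have k1: "1 \<le> k" using k top_level(1) by simp
  have sk: "s (Suc k) \<le> n" "s (Suc k) \<le> n'" using settled(1)[OF k1] n by auto
  have "head k *v column j (tail k n) \<noteq> 0"
    using j(1) by (simp add: column_class_def live_def column_P[OF settled_ge_s[OF k1 n(1)]])
  then show ?thesis
    unfolding err_def column_P[OF settled_ge_s[OF k1 n(1)]] column_P[OF settled_ge_s[OF k1 n(2)]]
    using sk by (intro head_direction_diff k1 balanced_column_tail column_class_same_support[OF k n j])
qed

definition limit_dir :: "'d set \<Rightarrow> real ^ 'd" where
  "limit_dir S = lim (\<lambda>n. column_dir (SOME j. j \<in> column_class S n) n)"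

text \<open>By \<open>column_dir_diff\<close> the choice of representatives does not matter and the directions form a
  Cauchy sequence.\<close>

lemma tendsto_limit_dir:
  assumes S: "S \<in> level_supports top_level"
  shows "(\<lambda>n. column_dir (SOME j. j \<in> column_class S n) n) \<longlonglongrightarrow> limit_dir S"
proof -
  let ?x = "\<lambda>n. column_dir (SOME j. j \<in> column_class S n) n"
  have rep: "(SOME j. j \<in> column_class S n) \<in> column_class S n" if "settled top_level \<le> n" for n
    using column_class_nonempty[OF that S] by (metis ex_in_conv someI_ex)
  have "Cauchy ?x"
  proof (rule metric_CauchyI)
    fix e :: real assume "0 < e"
    then obtain k where k: "top_level \<le> k" "err k < e" using err_small by blast
    define N where "N = max (settled k) (settled top_level)"
    have "dist (?x m) (?x n) < e" if "N \<le> m" "N \<le> n" for m n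
    proof -
      have "dist (?x m) (?x n) \<le> l1norm (?x m - ?x n)" by (simp add: dist_norm norm_le_l1norm)
      also have "\<dots> \<le> err k" using that by (intro column_dir_diff[OF k(1) _ _ rep rep]) (auto simp: N_def)
      finally show ?thesis using k(2) by simp
    qed
    then show "\<exists>N. \<forall>m\<ge>N. \<forall>n\<ge>N. dist (?x m) (?x n) < e" by blast
  qed
  then show ?thesis
    unfolding limit_dir_def by (simp add: Cauchy_convergent_iff convergent_LIMSEQ_iff)
qed

lemma column_dir_limit_diff:
  assumes S: "S \<in> level_supports top_level" and k: "top_level \<le> k" and n: "settled k \<le> n"
    and j: "j \<in> column_class S n"
  shows "l1norm (column_dir j n - limit_dir S) \<le> err k"
proof (rule LIMSEQ_le_const2)
  show "(\<lambda>n'. l1norm (column_dir j n - column_dir (SOME j. j \<in> column_class S n') n'))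
      \<longlonglongrightarrow> l1norm (column_dir j n - limit_dir S)"
    by (intro tendsto_l1norm tendsto_diff tendsto_const tendsto_limit_dir S)
  have "l1norm (column_dir j n - column_dir (SOME j. j \<in> column_class S n') n') \<le> err k"
    if "max (settled k) (settled top_level) \<le> n'" for n'
  proof (rule column_dir_diff[OF k])
    show "(SOME j. j \<in> column_class S n') \<in> column_class S n'"
      using column_class_nonempty[OF _ S, of n'] that by (metis ex_in_conv max.boundedE someI_ex)
  qed (use that n j in auto)
  then show "\<exists>N. \<forall>n'\<ge>N. l1norm (column_dir j n - column_dir (SOME j. j \<in> column_class S n') n') \<le> err k"
    by blast
qed

definition row_support :: "'d set \<Rightarrow> 'd set" where
  "row_support S = image_support (head top_level) S"

lemma supp_column_in_class:
  assumes n: "settled top_level \<le> n" and j: "j \<in> column_class S n"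
  shows "supp (column j (P A n)) = row_support S"
  using j unfolding column_P[OF settled_ge_s[OF top_level(1) n]]
  by (simp add: supp_mult_vec_eq_image_support nonneg_head nonneg_column nonneg_tail column_class_def
      row_support_def)

lemma balanced_column_P: "s 2 \<le> n \<Longrightarrow> balanced bal (column j (P A n))"
  unfolding P_eq_tail by (rule balanced_column_tail) (simp_all add: numeral_2_eq_2)

lemma column_dir_bounds:
  assumes n: "settled top_level \<le> n" and j: "j \<in> column_class S n"
  shows "i \<notin> row_support S \<Longrightarrow> column_dir j n $ i = 0"
    and "i \<in> row_support S \<Longrightarrow> 1 / bal \<le> column_dir j n $ i"
    and "l1norm (column_dir j n) = 1"
proof -
  let ?c = "column j (P A n)"
  have supp: "supp ?c = row_support S" by (rule supp_column_in_class[OF n j])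
  have nz: "?c \<noteq> 0" using j by (simp add: column_class_def live_def)
  then have pos: "0 < l1norm ?c" by (simp add: l1norm_pos_iff)
  show "l1norm (column_dir j n) = 1" using nz by (rule l1norm_direction)
  show "column_dir j n $ i = 0" if "i \<notin> row_support S"
    using that unfolding supp[symmetric] by (simp add: direction_nth in_supp_iff)
  assume "i \<in> row_support S"
  then have "?c $ i \<noteq> 0" unfolding supp[symmetric] by (simp add: in_supp_iff)
  have "s 2 \<le> n"
    using n settled(1)[OF top_level(1)] s_mono[of 2 "Suc top_level"] top_level(1) by simp
  from balancedD[OF balanced_column_P[OF this] \<open>?c $ i \<noteq> 0\<close>]
  show "1 / bal \<le> column_dir j n $ i"
    using pos bal_ge by (simp add: direction_nth field_simps)
qed

text \<open>Along a class the support of the columns is constant and their normalised nonzero entries are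
  at least \<open>1 / bal\<close>, so no entry is lost in the limit.\<close>

lemma limit_dir_props:
  assumes S: "S \<in> level_supports top_level"
  shows "limit_dir S \<in> prob_simplex" "supp (limit_dir S) = row_support S"
proof -
  let ?x = "\<lambda>n. column_dir (SOME j. j \<in> column_class S n) n"
  have rep: "(SOME j. j \<in> column_class S n) \<in> column_class S n" if "settled top_level \<le> n" for n
    using column_class_nonempty[OF that S] by (metis ex_in_conv someI_ex)
  note x = column_dir_bounds[OF _ rep]
  note lim = tendsto_limit_dir[OF S]
  have out: "limit_dir S $ i = 0" if "i \<notin> row_support S" for i
  proof (rule tendsto_unique[OF _ tendsto_vec_nth[OF lim]])
    have "\<forall>\<^sub>F n in sequentially. 0 = ?x n $ i"
      using eventually_ge_at_top[of "settled top_level"] by eventually_elim (use x(1) that in auto)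
    then show "(\<lambda>n. ?x n $ i) \<longlonglongrightarrow> 0" by (rule Lim_transform_eventually[OF tendsto_const])
  qed simp
  have inside: "1 / bal \<le> limit_dir S $ i" if "i \<in> row_support S" for i
    by (rule LIMSEQ_le_const[OF tendsto_vec_nth[OF lim]]) (use x(2) that in blast)
  have pos: "0 < limit_dir S $ i" if "i \<in> row_support S" for i
    using inside[OF that] bal_ge by (smt (verit) divide_pos_pos)
  show "supp (limit_dir S) = row_support S"
    using out pos by (force simp: in_supp_iff)
  have "l1norm (limit_dir S) = 1"
  proof (rule tendsto_unique[OF _ tendsto_l1norm[OF lim]])
    have "\<forall>\<^sub>F n in sequentially. 1 = l1norm (?x n)"
      using eventually_ge_at_top[of "settled top_level"] by eventually_elim (use x(3) in auto)
    then show "(\<lambda>n. l1norm (?x n)) \<longlonglongrightarrow> 1" by (rule Lim_transform_eventually[OF tendsto_const])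
  qed simp
  moreover have "0 \<le> limit_dir S $ i" for i
    using out[of i] pos[of i] by (cases "i \<in> row_support S") auto
  ultimately show "limit_dir S \<in> prob_simplex" by (simp add: prob_simplex_def)
qed

text \<open>At the top level the columns of two classes have different supports, so \<open>H3\<close> makes one of them
  negligible; multiplying by the fixed matrix \<open>head top_level\<close> costs only a constant factor.\<close>

lemma class_dominates:
  assumes S: "T \<subset> S" and e: "0 < e"
  shows "\<exists>N. \<forall>n\<ge>N. \<forall>j\<in>column_class S n. \<forall>j'\<in>column_class T n.
    l1norm (column j' (P A n)) \<le> e * l1norm (column j (P A n))"
proof -
  let ?m = top_level
  let ?M = "head ?m"
  obtain c where c: "\<And>V. balanced bal V \<Longrightarrow> ?M *v V \<noteq> 0 \<Longrightarrow> l1norm V \<le> c * l1norm (?M *v V)"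
    using l1norm_mult_vec_lower[OF nonneg_head bal_ge(3)] by metis
  define D where "D = (\<Sum>j\<in>UNIV. l1norm (column j ?M))"
  have D: "0 \<le> D" unfolding D_def by (intro sum_nonneg l1norm_ge_0)
  have "(\<lambda>r. D * c * lam ^ r) \<longlonglongrightarrow> 0"
    using lam by (intro tendsto_mult_right_zero LIMSEQ_realpow_zero)
  from order_tendstoD(2)[OF this e] obtain r0 where "\<And>r. r0 \<le> r \<Longrightarrow> D * c * lam ^ r < e"
    by (auto simp: eventually_sequentially)
  then obtain r where r: "1 \<le> r" "D * c * lam ^ r < e" by (meson max.cobounded1 max.cobounded2)
  have "l1norm (column j' (P A n)) \<le> e * l1norm (column j (P A n))"
    if n: "s (?m + r) \<le> n" and j: "j \<in> column_class S n" and j': "j' \<in> column_class T n" for n j j'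
  proof -
    let ?V = "column j (tail ?m n)" and ?W = "column j' (tail ?m n)"
    have sn: "s (Suc ?m) \<le> n" "s ?m \<le> n"
      using n r s_mono[of "Suc ?m" "?m + r"] s_mono[of ?m "?m + r"] by auto
    note col = column_P[OF sn(2)]
    obtain i where "i \<in> S" "i \<notin> T" using S by blast
    then have i: "tail ?m n $ i $ j \<noteq> 0" "tail ?m n $ i $ j' = 0"
      using j j' by (auto simp: column_class_def in_supp_iff column_nth)
    have "l1norm (column j' (P A n)) \<le> D * l1norm ?W"
      unfolding col D_def by (intro l1norm_mult_vec_upper nonneg_head nonneg_column nonneg_tail)
    also have "l1norm ?W \<le> lam ^ r * tail ?m n $ i $ j"
      by (rule H3D[OF tail_H3[OF top_level(1) n r(1)] i])
    also have "\<dots> \<le> lam ^ r * l1norm ?V"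
      using lam entry_le_l1norm[of ?V i] by (intro mult_left_mono) (auto simp: column_nth)
    also have "l1norm ?V \<le> c * l1norm (column j (P A n))"
      unfolding col using j by (intro c balanced_column_tail top_level(1) sn)
        (simp add: column_class_def live_def col)
    also have "D * (lam ^ r * (c * l1norm (column j (P A n)))) = D * c * lam ^ r * l1norm (column j (P A n))"
      by simp
    also have "\<dots> \<le> e * l1norm (column j (P A n))"
      using r(2) by (intro mult_right_mono l1norm_ge_0) auto
    finally show ?thesis using D lam by (simp add: mult_left_mono)
  qed
  then show ?thesis by blast
qed

end

section \<open>Convex combinations of columns\<close>

lemma Lambda_vec_ge:
  assumes X: "X \<in> prob_simplex" and i: "X $ i \<noteq> 0"
  shows "1 \<le> Lambda_vec X * X $ i" "1 \<le> Lambda_vec X"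
proof -
  let ?S = "{X $ i |i. X $ i \<noteq> 0}"
  have nn: "0 \<le> X $ k" for k using X by (simp add: prob_simplex_def)
  have "X $ i \<le> 1" using entry_le_l1norm[of X i] X by (simp add: prob_simplex_def)
  have "Min ?S \<in> ?S" using i by (intro Min_in) auto
  then have pos: "0 < Min ?S" using nn by (auto simp: less_le)
  have le: "Min ?S \<le> X $ i" using i by (intro Min_le) auto
  show "1 \<le> Lambda_vec X * X $ i" "1 \<le> Lambda_vec X"
    unfolding Lambda_vec_prob_simplex[OF X] using pos le \<open>X $ i \<le> 1\<close> by (auto simp: field_simps)
qed

text \<open>\<open>direction (M *v X)\<close> is the average of the directions of the columns of \<open>M\<close>, with weights
  \<open>X(j) * l1norm (column j M)\<close> up to normalisation. The columns that are not already close to \<open>v\<close> have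
  total weight at most \<open>c * Lambda_vec X\<close>, by comparison with the column \<open>j0\<close>.\<close>

lemma direction_mult_vec_near:
  fixes M :: "real ^ 'n ^ 'm"
  assumes M: "nonneg_mat M" and X: "X \<in> prob_simplex" and v: "v \<in> prob_simplex"
    and j0: "j0 \<in> supp X" "column j0 M \<noteq> 0"
    and near: "\<And>j. j \<in> supp X \<Longrightarrow> column j M \<noteq> 0 \<Longrightarrow>
      l1norm (direction (column j M) - v) \<le> \<eta> \<or> l1norm (column j M) \<le> c * l1norm (column j0 M)"
    and \<eta>: "0 \<le> \<eta>" and c: "0 \<le> c"
  shows "l1norm (direction (M *v X) - v) \<le> Lambda_vec X * (\<eta> + 2 * c)"
proof -
  have X0: "nonneg_vec X" and X1: "(\<Sum>j\<in>UNIV. X $ j) = 1" and v1: "l1norm v = 1"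
    using X v by (auto simp: prob_simplex_def nonneg_vec_def l1norm_def)
  have Xj0: "X $ j0 \<noteq> 0" using j0 by (simp add: in_supp_iff)
  note Lam = Lambda_vec_ge[OF X Xj0]
  let ?c = "\<lambda>j. l1norm (column j M)"
  define t where "t = l1norm (M *v X)"
  have t: "t = (\<Sum>j\<in>UNIV. X $ j * ?c j)" unfolding t_def by (rule l1norm_mult_vec[OF M X0])
  have c0: "0 < ?c j0" using j0 by (simp add: l1norm_pos_iff)
  have tj0: "X $ j0 * ?c j0 \<le> t"
    unfolding t by (rule member_le_sum) (auto intro: mult_nonneg_nonneg nonneg_vecD[OF X0] l1norm_ge_0)
  have Xj0pos: "0 < X $ j0" using Xj0 nonneg_vecD[OF X0, of j0] by simp
  have tpos: "0 < t" using tj0 Xj0pos c0 by (smt (verit) mult_pos_pos)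
  define w where "w j = X $ j * ?c j / t" for j
  have w0: "0 \<le> w j" for j
    unfolding w_def by (intro divide_nonneg_pos tpos mult_nonneg_nonneg nonneg_vecD[OF X0] l1norm_ge_0)
  have w1: "(\<Sum>j\<in>UNIV. w j) = 1"
    unfolding w_def sum_divide_distrib[symmetric] t[symmetric] using tpos by simp
  have wdir: "w j *\<^sub>R direction (column j M) = (X $ j / t) *\<^sub>R column j M" for j
    by (cases "column j M = 0") (auto simp: w_def direction_def l1norm_eq_0_iff field_simps)
  have "direction (M *v X) = inverse t *\<^sub>R (M *v X)"
    by (simp add: direction_def t_def)
  also have "\<dots> = (\<Sum>j\<in>UNIV. (X $ j / t) *\<^sub>R column j M)"
    by (simp add: mult_vec_columns scaleR_sum_right divide_inverse mult.commute)
  finally have "direction (M *v X) - v = (\<Sum>j\<in>UNIV. w j *\<^sub>R direction (column j M)) - (\<Sum>j\<in>UNIV. w j) *\<^sub>R v"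
    by (simp add: wdir w1)
  also have "\<dots> = (\<Sum>j\<in>UNIV. w j *\<^sub>R (direction (column j M) - v))"
    by (simp add: scaleR_sum_left sum_subtractf scaleR_diff_right)
  finally have "l1norm (direction (M *v X) - v) \<le> (\<Sum>j\<in>UNIV. w j * l1norm (direction (column j M) - v))"
    using l1norm_sum_le[of "\<lambda>j. w j *\<^sub>R (direction (column j M) - v)" UNIV] w0
    by (simp add: l1norm_scaleR)
  also have "\<dots> \<le> (\<Sum>j\<in>UNIV. w j * \<eta> + X $ j * (Lambda_vec X * (2 * c)))"
  proof (rule sum_mono)
    fix j
    have extra: "0 \<le> X $ j * (Lambda_vec X * (2 * c))"
      using Lam c nonneg_vecD[OF X0] by simp
    show "w j * l1norm (direction (column j M) - v) \<le> w j * \<eta> + X $ j * (Lambda_vec X * (2 * c))"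
    proof (cases "X $ j = 0 \<or> column j M = 0")
      case True
      then have "w j = 0" by (auto simp: w_def l1norm_zero)
      then show ?thesis using extra by simp
    next
      case False
      then have "l1norm (direction (column j M) - v) \<le> \<eta> \<or> ?c j \<le> c * ?c j0"
        using near[of j] by (simp add: in_supp_iff)
      then show ?thesis
      proof
        assume "l1norm (direction (column j M) - v) \<le> \<eta>"
        then have "w j * l1norm (direction (column j M) - v) \<le> w j * \<eta>"
          by (rule mult_left_mono[OF _ w0])
        then show ?thesis using extra by linarith
      next
        assume small: "?c j \<le> c * ?c j0"
        have "?c j0 * 1 \<le> ?c j0 * (Lambda_vec X * X $ j0)"
          using Lam(1) by (intro mult_left_mono l1norm_ge_0)
        also have "\<dots> = Lambda_vec X * (X $ j0 * ?c j0)" by simp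
        also have "\<dots> \<le> Lambda_vec X * t" using tj0 Lam(2) by (intro mult_left_mono) auto
        finally have "c * ?c j0 \<le> c * (Lambda_vec X * t)" using c by (intro mult_left_mono) auto
        then have "X $ j * ?c j \<le> X $ j * (c * (Lambda_vec X * t))"
          using small by (intro mult_left_mono nonneg_vecD[OF X0]) auto
        then have "w j \<le> X $ j * (Lambda_vec X * c)"
          using tpos by (simp add: w_def pos_divide_le_eq mult_ac)
        moreover have "l1norm (direction (column j M) - v) \<le> 2"
          using l1norm_diff_le[of "direction (column j M)" v] l1norm_direction[of "column j M"] False v1 by simp
        ultimately have "w j * l1norm (direction (column j M) - v) \<le> X $ j * (Lambda_vec X * c) * 2"
          using w0[of j] by (intro mult_mono l1norm_ge_0) auto
        moreover have "0 \<le> w j * \<eta>" using w0 \<eta> by simp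
        ultimately show ?thesis by simp
      qed
    qed
  qed
  also have "\<dots> = \<eta> + Lambda_vec X * (2 * c)"
    by (simp add: sum.distrib sum_distrib_right[symmetric] w1 X1)
  also have "\<dots> \<le> Lambda_vec X * \<eta> + Lambda_vec X * (2 * c)"
    using mult_right_mono[OF Lam(2) \<eta>] by simp
  finally show ?thesis by (simp add: distrib_left)
qed

section \<open>Grouping a chain by values, and uniform bounds\<close>

text \<open>Neighbouring members of the chain with the same value under \<open>f\<close> are put into one group. Members
  that are not neighbours may share a value without being grouped.\<close>

lemma chain_grouping:
  fixes f :: "'a set \<Rightarrow> 'b"
  assumes "finite C" "C \<noteq> {}" "\<And>S T. S \<in> C \<Longrightarrow> T \<in> C \<Longrightarrow> S \<subseteq> T \<or> T \<subseteq> S"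
  shows "\<exists>H g V. 1 \<le> H \<and> H \<le> card C \<and> g ` C = {1..H} \<and> (\<forall>S\<in>C. f S = V (g S)) \<and>
    (\<forall>S\<in>C. \<forall>T\<in>C. T \<subseteq> S \<longrightarrow> g S \<le> g T) \<and> (\<forall>h\<in>{2..H}. V (h - 1) \<noteq> V h)"
  using assms
proof (induction "card C" arbitrary: C)
  case 0
  then show ?case by simp
next
  case (Suc p)
  (* The least member B joins the last group of the others, or forms a new group after it. *)
  obtain B where B: "B \<in> C" "\<And>S. S \<in> C \<Longrightarrow> B \<subseteq> S"
    using finite_has_minimal[OF Suc.prems(1,2)] Suc.prems(3) by (metis)
  let ?D = "C - {B}"
  have card: "p = card ?D" using Suc B(1) by simp
  show ?case
  proof (cases "?D = {}")
    case True
    then have "C = {B}" using B by auto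
    then show ?thesis
      by (intro exI[of _ 1] exI[of _ "\<lambda>_. 1"] exI[of _ "\<lambda>_. f B"]) auto
  next
    case False
    have "\<exists>H g V. 1 \<le> H \<and> H \<le> card ?D \<and> g ` ?D = {1..H} \<and> (\<forall>S\<in>?D. f S = V (g S)) \<and>
      (\<forall>S\<in>?D. \<forall>T\<in>?D. T \<subseteq> S \<longrightarrow> g S \<le> g T) \<and> (\<forall>h\<in>{2..H}. V (h - 1) \<noteq> V h)"
      using Suc.prems False by (intro Suc.hyps(1) card) auto
    then obtain H g and V :: "nat \<Rightarrow> 'b" where IH: "1 \<le> H" "H \<le> card ?D" "g ` ?D = {1..H}"
      "\<And>S. S \<in> ?D \<Longrightarrow> f S = V (g S)"
      "\<And>S T. S \<in> ?D \<Longrightarrow> T \<in> ?D \<Longrightarrow> T \<subseteq> S \<Longrightarrow> g S \<le> g T"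
      "\<And>h. h \<in> {2..H} \<Longrightarrow> V (h - 1) \<noteq> V h"
      by metis
    have gH: "g S \<le> H" "1 \<le> g S" if "S \<in> ?D" for S using IH(3) that by force+
    have notB: "\<not> S \<subseteq> B" if "S \<in> ?D" for S using B that by blast
    show ?thesis
    proof (cases "f B = V H")
      case True
      let ?g = "g(B := H)"
      have "?g ` C = {1..H}"
        using IH(1,3) B(1) by (auto simp: image_iff)
      moreover have "?g S \<le> ?g T" if "S \<in> C" "T \<in> C" "T \<subseteq> S" for S T
        using that gH[of S] IH(5)[of S T] notB[of T] by auto
      moreover have "f S = V (?g S)" if "S \<in> C" for S using that True IH(4) by auto
      ultimately show ?thesis using IH(1,2,6) card Suc(2)
        by (intro exI[of _ H] exI[of _ ?g] exI[of _ V]) auto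
    next
      case False
      let ?g = "g(B := Suc H)" and ?V = "V(Suc H := f B)"
      have "?g ` C = insert (Suc H) (g ` ?D)" using B(1) by auto
      also have "\<dots> = {1..Suc H}" unfolding IH(3) by auto
      finally have "?g ` C = {1..Suc H}" .
      moreover have "?g S \<le> ?g T" if "S \<in> C" "T \<in> C" "T \<subseteq> S" for S T
        using that gH[of S] IH(5)[of S T] notB[of T] by (cases "S = B"; cases "T = B") auto
      moreover have "f S = ?V (?g S)" if "S \<in> C" for S using that gH[of S] IH(4)[of S] by (cases "S = B") auto
      moreover have "?V (h - 1) \<noteq> ?V h" if "h \<in> {2..Suc H}" for h
        using that IH(6)[of h] False by (cases "h = Suc H") auto
      ultimately show ?thesis using IH(1,2) card Suc(2)
        by (intro exI[of _ "Suc H"] exI[of _ ?g] exI[of _ ?V]) auto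
    qed
  qed
qed

text \<open>Over a finite index set, termwise smallness of \<open>f n i\<close> along the relation \<open>R\<close> is uniform; the sum of
  the terms with \<open>R n i\<close> is a common bound.\<close>

lemma uniform_null_bound:
  fixes f :: "nat \<Rightarrow> 'i \<Rightarrow> real"
  assumes I: "finite I" and f0: "\<And>n i. 0 \<le> f n i"
    and lim: "\<And>e i. 0 < e \<Longrightarrow> i \<in> I \<Longrightarrow> \<exists>N. \<forall>n\<ge>N. R n i \<longrightarrow> f n i \<le> e"
  shows "\<exists>\<eta>. \<eta> \<longlonglongrightarrow> 0 \<and> (\<forall>n. 0 \<le> \<eta> n) \<and> (\<forall>n. \<forall>i\<in>I. R n i \<longrightarrow> f n i \<le> \<eta> n)"
proof (intro exI conjI allI ballI impI)
  let ?h = "\<lambda>n i. if R n i then f n i else 0"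
  let ?\<eta> = "\<lambda>n. \<Sum>i\<in>I. ?h n i"
  show "?\<eta> \<longlonglongrightarrow> 0"
  proof (rule tendsto_null_sum)
    fix i assume i: "i \<in> I"
    show "(\<lambda>n. ?h n i) \<longlonglongrightarrow> 0"
    proof (rule LIMSEQ_I)
      fix e :: real assume "0 < e"
      then obtain N where "\<And>n. N \<le> n \<Longrightarrow> R n i \<Longrightarrow> f n i \<le> e / 2" using lim[of "e / 2" i] i by auto
      then have "norm (?h n i - 0) < e" if "N \<le> n" for n
        using that f0[of n i] \<open>0 < e\<close> by fastforce
      then show "\<exists>N. \<forall>n\<ge>N. norm (?h n i - 0) < e" by blast
    qed
  qed
  show "0 \<le> ?\<eta> n" for n using f0 by (simp add: sum_nonneg)
  show "f n i \<le> ?\<eta> n" if "i \<in> I" "R n i" for n i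
    using member_le_sum[OF that(1), of "?h n"] that(2) f0 I by simp
qed

section \<open>The theorem\<close>

theorem theoremA:
  fixes A :: "nat \<Rightarrow> real ^ 'd ^ 'd" and lam \<Lambda> :: real and s :: "nat \<Rightarrow> nat"
  assumes "\<forall>n\<ge>1. nonneg_mat (A n)"
    and "condition_C A lam \<Lambda> s"
    and "\<forall>n\<ge>1. P A n \<noteq> 0"
  shows "\<exists>(H::nat) (V :: nat \<Rightarrow> real ^ 'd) (J :: nat \<Rightarrow> nat \<Rightarrow> 'd set) (N::nat).
    1 \<le> H \<and> H \<le> CARD('d) \<and> 1 \<le> N \<and>
    (\<forall>h\<in>{1..H}. V h \<in> prob_simplex) \<and>
    (\<forall>h\<in>{2..H}. Delta (V (h - 1)) \<ge> Delta (V h) \<and> V (h - 1) \<noteq> V h) \<and>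
    (\<forall>n\<ge>N.
       (\<forall>h\<in>{1..H}. J h n \<noteq> {}) \<and>
       {(i, j). P A n $ i $ j \<noteq> 0} = (\<Union>h\<in>{1..H}. supp (V h) \<times> J h n) \<and>
       disjoint_family_on (\<lambda>h. supp (V h) \<times> J h n) {1..H}) \<and>
    (\<forall>h\<in>{1..H}. \<forall>j :: nat \<Rightarrow> 'd.
       (\<forall>\<^sub>F n in sequentially. j n \<in> J h n) \<longrightarrow>
       (\<lambda>n. column (j n) (P A n) /\<^sub>R l1norm (column (j n) (P A n))) \<longlonglongrightarrow> V h) \<and>
    (\<forall>h\<in>{2..H}. \<forall>j j' :: nat \<Rightarrow> 'd.
       (\<forall>\<^sub>F n in sequentially. (j n, j' n) \<in> J (h - 1) n \<times> J h n) \<longrightarrow>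
       (\<lambda>n. l1norm (column (j' n) (P A n)) / l1norm (column (j n) (P A n))) \<longlonglongrightarrow> 0) \<and>
    (\<exists>\<epsilon> :: nat \<Rightarrow> real. \<epsilon> \<longlonglongrightarrow> 0 \<and>
       (\<forall>X\<in>prob_simplex. (\<forall>n\<ge>1. P A n *v X \<noteq> 0) \<longrightarrow>
          (\<forall>n\<ge>N. l1norm ((P A n *v X) /\<^sub>R l1norm (P A n *v X)
                       - V (Min {h \<in> {1..H}. supp X \<inter> J h n \<noteq> {}}))
                   \<le> Lambda_vec X * \<epsilon> n)))"
proof -
  interpret block_products A lam \<Lambda> s using assms by unfold_locales
  let ?C = "level_supports top_level"
  let ?col = "\<lambda>j n. column j (P A n)"
  obtain H g and V :: "nat \<Rightarrow> real ^ 'd" where H: "1 \<le> H" "H \<le> card ?C"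
    and g: "g ` ?C = {1..H}"
    and gV: "\<And>S. S \<in> ?C \<Longrightarrow> limit_dir S = V (g S)"
    and g_anti: "\<And>S T. S \<in> ?C \<Longrightarrow> T \<in> ?C \<Longrightarrow> T \<subseteq> S \<Longrightarrow> g S \<le> g T"
    and V_neq: "\<And>h. h \<in> {2..H} \<Longrightarrow> V (h - 1) \<noteq> V h"
    using chain_grouping[OF finite_level_supports level_supports_nonempty[OF top_level(1)]
        level_supports_chain[OF top_level(1)], of limit_dir] by metis
  (* A group may collect several neighbouring classes with the same limit direction. *)
  define J where "J h n = (\<Union>S\<in>{S\<in>?C. g S = h}. column_class S n)" for h n
  define N where "N = settled top_level"
  have N1: "1 \<le> N"
    using settled(1)[OF top_level(1)] s_Suc_pos[OF top_level(1)] by (simp add: N_def)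
  have J_iff: "j \<in> J h n \<longleftrightarrow> (\<exists>S\<in>?C. g S = h \<and> j \<in> column_class S n)" for j h n
    by (auto simp: J_def)
  have J_live: "?col j n \<noteq> 0" if "j \<in> J h n" for j h n
    using that by (auto simp: J_iff column_class_def live_def)
  have J_unique: "h = h'" if "j \<in> J h n" "j \<in> J h' n" for j h h' n
    using that by (auto simp: J_iff column_class_def)
  have g_surj: "\<exists>S\<in>?C. g S = h" if "h \<in> {1..H}" for h
    using that unfolding g[symmetric] by blast
  have g_strict: "T \<subset> S" if "S \<in> ?C" "T \<in> ?C" "g S < g T" for S T
    using level_supports_chain[OF top_level(1) that(1,2)] g_anti[OF that(2,1)] that(3) by auto
  have V_prob: "V h \<in> prob_simplex" if "h \<in> {1..H}" for h
    using g_surj[OF that] gV limit_dir_props(1) by metis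
  have J_supp: "supp (?col j n) = supp (V h)" if "N \<le> n" "j \<in> J h n" for j h n
  proof -
    obtain S where "S \<in> ?C" "g S = h" "j \<in> column_class S n" using \<open>j \<in> J h n\<close> J_iff by blast
    then show ?thesis
      using supp_column_in_class[of n j S] limit_dir_props(2)[of S] gV[of S] \<open>N \<le> n\<close> by (simp add: N_def)
  qed
  have J_cover: "\<exists>h\<in>{1..H}. j \<in> J h n" if "N \<le> n" "?col j n \<noteq> 0" for j n
    using live_in_class[of n j] that g by (auto simp: J_iff live_def N_def)

  have card: "H \<le> CARD('d)" using H(2) card_level_supports by (rule le_trans)
  have order: "Delta (V (h - 1)) \<ge> Delta (V h) \<and> V (h - 1) \<noteq> V h" if h: "h \<in> {2..H}" for h
  proof -
    obtain S where S: "S \<in> ?C" "g S = h - 1" using g_surj[of "h - 1"] h by force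
    obtain T where T: "T \<in> ?C" "g T = h" using g_surj[of h] h by force
    have "T \<subset> S" using S T h by (intro g_strict) auto
    then have "row_support T \<subseteq> row_support S" by (auto simp: row_support_def image_support_def)
    then have "supp (V h) \<subseteq> supp (V (h - 1))"
      using S T gV limit_dir_props(2) by metis
    then show ?thesis using V_neq[OF h] by (simp add: Delta_le_iff)
  qed
  have partition: "{(i, j). P A n $ i $ j \<noteq> 0} = (\<Union>h\<in>{1..H}. supp (V h) \<times> J h n)" if n: "N \<le> n" for n
  proof (intro set_eqI iffI; clarify)
    fix i j assume ij: "P A n $ i $ j \<noteq> 0"
    then have "?col j n \<noteq> 0" by (auto simp: vec_eq_iff column_nth)
    then obtain h where "h \<in> {1..H}" "j \<in> J h n" using J_cover[OF n] by blast
    then show "(i, j) \<in> (\<Union>h\<in>{1..H}. supp (V h) \<times> J h n)"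
      using ij J_supp[OF n, of j h] by (auto simp: in_supp_iff column_nth set_eq_iff)
  next
    fix i j h assume "i \<in> supp (V h)" "j \<in> J h n" "P A n $ i $ j = 0"
    then show False using J_supp[OF n, of j h] by (simp add: in_supp_iff column_nth set_eq_iff)
  qed
  have disjoint: "disjoint_family_on (\<lambda>h. supp (V h) \<times> J h n) {1..H}" for n
    using J_unique by (auto simp: disjoint_family_on_def)
  have nonempty: "J h n \<noteq> {}" if n: "N \<le> n" and h: "h \<in> {1..H}" for h n
  proof -
    obtain S where S: "S \<in> ?C" "g S = h" using g_surj[OF h] by blast
    obtain j where "j \<in> column_class S n"
      using column_class_nonempty[OF n[unfolded N_def] S(1)] by blast
    then have "j \<in> J h n" using S J_iff by blast
    then show ?thesis by blast
  qed

  have "\<exists>\<eta>. \<eta> \<longlonglongrightarrow> 0 \<and> (\<forall>n. 0 \<le> \<eta> n) \<and> (\<forall>n. \<forall>i\<in>UNIV \<times> {1..H}.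
      (case i of (j, h) \<Rightarrow> j \<in> J h n) \<longrightarrow> (case i of (j, h) \<Rightarrow> l1norm (column_dir j n - V h)) \<le> \<eta> n)"
  proof (rule uniform_null_bound)
    fix e :: real and i assume "0 < e"
    obtain k where k: "top_level \<le> k" "err k < e" using err_small[OF \<open>0 < e\<close>] by blast
    have "l1norm (column_dir j n - V h) \<le> e" if "settled k \<le> n" "j \<in> J h n" for n j h
      using that(2) column_dir_limit_diff[OF _ k(1) that(1)] k(2) gV by (fastforce simp: J_iff)
    then show "\<exists>N. \<forall>n\<ge>N. (case i of (j, h) \<Rightarrow> j \<in> J h n) \<longrightarrow>
        (case i of (j, h) \<Rightarrow> l1norm (column_dir j n - V h)) \<le> e"
      by (intro exI[of _ "settled k"]) (auto split: prod.split)
  qed (auto simp: l1norm_ge_0)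
  then obtain \<eta> where \<eta>: "\<eta> \<longlonglongrightarrow> 0" "\<And>n. 0 \<le> \<eta> n"
    and \<eta>_bound: "\<And>n j h. h \<in> {1..H} \<Longrightarrow> j \<in> J h n \<Longrightarrow> l1norm (column_dir j n - V h) \<le> \<eta> n"
    by fastforce
  define dominated where
    "dominated n = (\<lambda>(j, j', S, T). T \<subset> S \<and> j \<in> column_class S n \<and> j' \<in> column_class T n)" for n
  define ratio where "ratio n = (\<lambda>(j, j', S :: 'd set, T :: 'd set). l1norm (?col j' n) / l1norm (?col j n))" for n
  have "\<exists>\<delta>. \<delta> \<longlonglongrightarrow> 0 \<and> (\<forall>n. 0 \<le> \<delta> n) \<and> (\<forall>n. \<forall>i\<in>UNIV. dominated n i \<longrightarrow> ratio n i \<le> \<delta> n)"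
  proof (rule uniform_null_bound)
    fix e :: real and i :: "'d \<times> 'd \<times> 'd set \<times> 'd set" assume e: "0 < e"
    obtain j j' S T where i: "i = (j, j', S, T)" by (cases i)
    show "\<exists>N. \<forall>n\<ge>N. dominated n i \<longrightarrow> ratio n i \<le> e"
    proof (cases "T \<subset> S")
      case True
      obtain N where N: "\<And>n. N \<le> n \<Longrightarrow> j \<in> column_class S n \<Longrightarrow> j' \<in> column_class T n \<Longrightarrow>
          l1norm (?col j' n) \<le> e * l1norm (?col j n)"
        using class_dominates[OF True e] by blast
      have "ratio n i \<le> e" if "N \<le> n" "dominated n i" for n
      proof -
        have "0 < l1norm (?col j n)"
          using that(2) by (simp add: i dominated_def column_class_def live_def l1norm_pos_iff)
        then show ?thesis
          using N[OF that(1)] that(2) by (simp add: i dominated_def ratio_def pos_divide_le_eq)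
      qed
      then show ?thesis by blast
    qed (simp add: i dominated_def)
  qed (auto simp: ratio_def l1norm_ge_0 split: prod.split)
  then obtain \<delta> where \<delta>: "\<delta> \<longlonglongrightarrow> 0" "\<And>n. 0 \<le> \<delta> n"
    and all_ratios: "\<And>n i. dominated n i \<Longrightarrow> ratio n i \<le> \<delta> n"
    by blast
  have \<delta>_class: "l1norm (?col j' n) / l1norm (?col j n) \<le> \<delta> n"
    if "T \<subset> S" "j \<in> column_class S n" "j' \<in> column_class T n" for n j j' S T
    using all_ratios[of n "(j, j', S, T)"] that by (simp add: dominated_def ratio_def)
  have \<delta>_bound: "l1norm (?col j' n) / l1norm (?col j n) \<le> \<delta> n"
    if less: "h < h'" and j: "j \<in> J h n" and j': "j' \<in> J h' n" for n j j' h h'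
  proof -
    obtain S T where "S \<in> ?C" "g S = h" "j \<in> column_class S n" "T \<in> ?C" "g T = h'" "j' \<in> column_class T n"
      using j j' unfolding J_iff by blast
    then show ?thesis using g_strict[of S T] \<delta>_class[of T S j n j'] less by simp
  qed

  have directions: "(\<lambda>n. ?col (j n) n /\<^sub>R l1norm (?col (j n) n)) \<longlonglongrightarrow> V h"
    if h: "h \<in> {1..H}" and j: "\<forall>\<^sub>F n in sequentially. j n \<in> J h n" for h j
  proof -
    have "\<forall>\<^sub>F n in sequentially. norm (column_dir (j n) n - V h) \<le> \<eta> n"
      using j by eventually_elim (use \<eta>_bound[OF h] norm_le_l1norm order_trans in blast)
    then have "(\<lambda>n. column_dir (j n) n - V h) \<longlonglongrightarrow> 0" by (rule Lim_null_comparison[OF _ \<eta>(1)])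
    then show ?thesis unfolding direction_def[symmetric] by (simp add: LIM_zero_iff)
  qed
  have ratios: "(\<lambda>n. l1norm (?col (j' n) n) / l1norm (?col (j n) n)) \<longlonglongrightarrow> 0"
    if h: "h \<in> {2..H}" and j: "\<forall>\<^sub>F n in sequentially. (j n, j' n) \<in> J (h - 1) n \<times> J h n" for h j j'
  proof (rule Lim_null_comparison[OF _ \<delta>(1)])
    have "h - 1 < h" using h by auto
    note * = \<delta>_bound[OF this]
    show "\<forall>\<^sub>F n in sequentially. norm (l1norm (?col (j' n) n) / l1norm (?col (j n) n)) \<le> \<delta> n"
      using j by eventually_elim (use * in \<open>auto simp: l1norm_ge_0\<close>)
  qed
  have vectors: "l1norm ((P A n *v X) /\<^sub>R l1norm (P A n *v X) - V (Min {h \<in> {1..H}. supp X \<inter> J h n \<noteq> {}}))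
      \<le> Lambda_vec X * (\<eta> n + 2 * \<delta> n)"
    if X: "X \<in> prob_simplex" and nz: "\<forall>n\<ge>1. P A n *v X \<noteq> 0" and n: "N \<le> n" for X n
  proof -
    let ?F = "{h \<in> {1..H}. supp X \<inter> J h n \<noteq> {}}"
    have X0: "nonneg_vec X" using X by (simp add: prob_simplex_def nonneg_vec_def)
    have F: "\<exists>h\<in>?F. j \<in> J h n" if "j \<in> supp X" "?col j n \<noteq> 0" for j
      using J_cover[OF n that(2)] that(1) by blast
    have "P A n *v X \<noteq> 0" using nz N1 n by simp
    then obtain i where "i \<in> supp (P A n *v X)" by (metis ex_in_conv supp_empty_iff)
    then obtain j where "j \<in> supp X" "P A n $ i $ j \<noteq> 0" using in_supp_mult_vec_iff[OF nonneg_P X0] by blast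
    then have "?F \<noteq> {}" using F[of j] by (force simp: vec_eq_iff column_nth)
    then have min: "Min ?F \<in> ?F" by (intro Min_in) auto
    then obtain j0 where j0: "j0 \<in> supp X" "j0 \<in> J (Min ?F) n" by blast
    show ?thesis
      unfolding direction_def[symmetric]
    proof (rule direction_mult_vec_near[OF nonneg_P X _ j0(1) J_live[OF j0(2)]])
      show "V (Min ?F) \<in> prob_simplex" using min V_prob by blast
      fix j assume j: "j \<in> supp X" "?col j n \<noteq> 0"
      then obtain h where h: "h \<in> ?F" "j \<in> J h n" using F by blast
      then have "Min ?F \<le> h" by (intro Min_le) auto
      then consider "h = Min ?F" | "Min ?F < h" by linarith
      then show "l1norm (column_dir j n - V (Min ?F)) \<le> \<eta> n \<or> l1norm (?col j n) \<le> \<delta> n * l1norm (?col j0 n)"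
      proof cases
        case 1
        then show ?thesis using \<eta>_bound h by blast
      next
        case 2
        have "0 < l1norm (?col j0 n)" using J_live[OF j0(2)] by (simp add: l1norm_pos_iff)
        then show ?thesis using \<delta>_bound[OF 2 j0(2) h(2)] by (simp add: pos_divide_le_eq)
      qed
    qed (use \<eta>(2) \<delta>(2) in auto)
  qed
  have null: "(\<lambda>n. \<eta> n + 2 * \<delta> n) \<longlonglongrightarrow> 0"
    using tendsto_add[OF \<eta>(1) tendsto_mult_right_zero[OF \<delta>(1)]] by simp
  have all: "\<forall>n\<ge>N. (\<forall>h\<in>{1..H}. J h n \<noteq> {}) \<and>
       {(i, j). P A n $ i $ j \<noteq> 0} = (\<Union>h\<in>{1..H}. supp (V h) \<times> J h n) \<and>
       disjoint_family_on (\<lambda>h. supp (V h) \<times> J h n) {1..H}"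
    using nonempty partition disjoint by simp
  show ?thesis
  proof (rule exI[of _ H], rule exI[of _ V], rule exI[of _ J], rule exI[of _ N], intro conjI)
    show "\<exists>\<epsilon>. \<epsilon> \<longlonglongrightarrow> 0 \<and>
       (\<forall>X\<in>prob_simplex. (\<forall>n\<ge>1. P A n *v X \<noteq> 0) \<longrightarrow>
          (\<forall>n\<ge>N. l1norm ((P A n *v X) /\<^sub>R l1norm (P A n *v X)
                       - V (Min {h \<in> {1..H}. supp X \<inter> J h n \<noteq> {}}))
                   \<le> Lambda_vec X * \<epsilon> n))"
      using null vectors by (intro exI[of _ "\<lambda>n. \<eta> n + 2 * \<delta> n"]) simp
  qed (rule H(1) card N1 all | (intro ballI allI impI V_prob order directions ratios; assumption))+
qed

end
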